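(* Let $p\in(0,1)$ be a constant (independent of $n$) and set $q:=1/(1-p)$. Let $\Delta\ge 3$ be a constant integer. Then, with probability tending to $1$ as $n\to\infty$, 1. $\mathbf{T}_{\Delta}$ equals either $\lceil 2\log_{q}(a_{\Delta}np)+1\rceil$ or $\lceil 2\log_{q}(a_{\Delta}np)+2\rceil$; 2. $\mathbf{F}_{\Delta}$ equals either $\lceil 2\log_{q}(a_{\Delta}np)+1\rceil$ or $\lceil 2\log_{q}(a_{\Delta}np)+2\rceil$.
   Context: $G(n,p)$ is the binomial random graph on vertex set $[n]=\{1,\dots,n\}$ in which each pair of vertices is joined by an edge independently with probability $p$. $\mathbf{T}_{\Delta}$ denotes the maximum number of vertices of an induced subgraph of $G(n,p)$ that is a tree with maximum degree at most $\Delta$, and $\mathbf{F}_{\Delta}$ denotes the maximum number of vertices of an induced subgraph of $G(n,p)$ that is a forest with maximum degree at most $\Delta$. For an integer $\Delta\ge2$ let $\gamma_{\Delta}(x)=\sum_{k=0}^{\Delta-1}x^k/k!$ for $x>0$. For $\Delta\ge3$, $\alpha_{\Delta}\in(1,\infty)$ is the unique solution of $x\gamma_{\Delta-1}(x)/\gamma_{\Delta}(x)=1$, and $a_{\Delta}:=\gamma_{\Delta-1}(\alpha_{\Delta})$. *)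

theory Defs
  imports "HOL-Probability.Probability"
begin

text \<open>A simple graph is given by a vertex set and a set of two-element subsets of it.\<close>

definition vertex_pairs :: "'a set \<Rightarrow> 'a set set" where
  "vertex_pairs V = {e. e \<subseteq> V \<and> card e = 2}"

definition gnp :: "nat \<Rightarrow> real \<Rightarrow> nat set set pmf" where
  "gnp n p = map_pmf (\<lambda>X. {e \<in> vertex_pairs {1..n}. X e})
     (Pi_pmf (vertex_pairs {1..n}) False (\<lambda>_. bernoulli_pmf p))"

definition induced_edges :: "'a set set \<Rightarrow> 'a set \<Rightarrow> 'a set set" where
  "induced_edges E S = {e \<in> E. e \<subseteq> S}"

definition graph_degree :: "'a set set \<Rightarrow> 'a \<Rightarrow> nat" where
  "graph_degree E v = card {e \<in> E. v \<in> e}"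

definition max_degree_le :: "'a set \<Rightarrow> 'a set set \<Rightarrow> nat \<Rightarrow> bool" where
  "max_degree_le V E \<Delta> \<longleftrightarrow> (\<forall>v\<in>V. graph_degree E v \<le> \<Delta>)"

definition connected_graph :: "'a set \<Rightarrow> 'a set set \<Rightarrow> bool" where
  "connected_graph V E \<longleftrightarrow>
     V \<noteq> {} \<and> (\<forall>u\<in>V. \<forall>v\<in>V. (u, v) \<in> {(x, y). {x, y} \<in> E}\<^sup>*)"

text \<open>A cycle is listed by its vertices in cyclic order, without repeating the first one.\<close>

definition graph_cycle :: "'a set set \<Rightarrow> 'a list \<Rightarrow> bool" where
  "graph_cycle E xs \<longleftrightarrow> 3 \<le> length xs \<and> distinct xs \<and>
     (\<forall>i<length xs. {xs ! i, xs ! (Suc i mod length xs)} \<in> E)"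

definition forest_graph :: "'a set set \<Rightarrow> bool" where
  "forest_graph E \<longleftrightarrow> (\<nexists>xs. graph_cycle E xs)"

definition tree_graph :: "'a set \<Rightarrow> 'a set set \<Rightarrow> bool" where
  "tree_graph V E \<longleftrightarrow> connected_graph V E \<and> forest_graph E"

text \<open>
  A tree has at least one vertex, so \<open>max_induced_tree\<close> is unspecified when \<open>V\<close> is empty;
  for finite nonempty \<open>V\<close> the maximum is over a finite nonempty set.
\<close>

definition max_induced_tree :: "nat \<Rightarrow> 'a set \<Rightarrow> 'a set set \<Rightarrow> nat" where
  "max_induced_tree \<Delta> V E = Max {card S | S. S \<subseteq> V \<and>
     tree_graph S (induced_edges E S) \<and> max_degree_le S (induced_edges E S) \<Delta>}"

definition max_induced_forest :: "nat \<Rightarrow> 'a set \<Rightarrow> 'a set set \<Rightarrow> nat" where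
  "max_induced_forest \<Delta> V E = Max {card S | S. S \<subseteq> V \<and>
     forest_graph (induced_edges E S) \<and> max_degree_le S (induced_edges E S) \<Delta>}"

definition gamma_trunc :: "nat \<Rightarrow> real \<Rightarrow> real" where
  "gamma_trunc \<Delta> x = (\<Sum>k=0..\<Delta>-1. x ^ k / fact k)"

definition alpha_crit :: "nat \<Rightarrow> real" where
  "alpha_crit \<Delta> =
     (THE x. 1 < x \<and> x * gamma_trunc (\<Delta> - 1) x / gamma_trunc \<Delta> x = 1)"

definition a_crit :: "nat \<Rightarrow> real" where
  "a_crit \<Delta> = gamma_trunc (\<Delta> - 1) (alpha_crit \<Delta>)"

end

theory Submission
  imports Defs "HOL-Computational_Algebra.Polynomial" "HOL-Real_Asymp.Real_Asymp"
begin

text \<open>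
  Put \<open>w = p / (1 - p)\<close>. There are \<open>(k - 2)! / (\<Prod>v. d v!)\<close> trees on \<open>k\<close> labelled vertices with
  degrees \<open>d v + 1\<close> (provided that \<open>(\<Sum>v. d v) = k - 2\<close>), so the number \<open>t\<^sub>k\<close> of trees of maximum degree at most \<open>\<Delta>\<close> is
  \<open>(k - 2)!\<close> times the coefficient of \<open>x ^ (k - 2)\<close> in \<open>\<gamma>\<^sub>\<Delta>(x) ^ k\<close>. At the saddle point \<open>\<alpha>\<^sub>\<Delta>\<close> this gives
  \<open>t\<^sub>k \<le> C * k! * a\<^sub>\<Delta> ^ k / k\<^sup>2\<close>, and \<open>t\<^sub>k \<ge> k! * (a\<^sub>\<Delta> / \<rho>) ^ k\<close> for every \<open>\<rho> > 1\<close> and large \<open>k\<close>.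

  Splitting off the component of a vertex turns the upper bound into
  \<open>(\<Sum>F. w ^ |F|) = o(k! * (a\<^sub>\<Delta> * w) ^ k)\<close> for forests \<open>F\<close> on \<open>k\<close> vertices, so the expected number of
  induced forests of size at least \<open>2 * log q (a\<^sub>\<Delta> n p) + 3\<close> tends to 0. At size
  \<open>\<lceil>2 * log q (a\<^sub>\<Delta> n p) + 1\<rceil>\<close> the expected number of induced trees is exponentially large in \<open>k\<close>. This leaves
  so much room in the second moment that pairs overlapping in at most \<open>k / 2\<close> vertices may be
  bounded by ignoring the compatibility of the two trees, and the others by crudely counting the
  extensions of a given intersection.
\<close>

section \<open>Trees and forests\<close>

text \<open>The number \<open>a_crit\<close> arises by minimising G(x)^k / x^(k - 2) with G =
  \<open>gamma_trunc \<Delta>\<close>: to leading order stationarity reads x G'(x) = G(x), and since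
  G' = \<open>gamma_trunc (\<Delta> - 1)\<close>, the minimum of G(x) / x is G'(\<alpha>) = a. The
  upper bound leaves no room to spare. With h = (1 - p)^(1/4), the union bound at size K is (a w n
  h^(2 (K - 1)))^K times a correction. At K = k + 2, where k is the smaller of the two values, the
  base is at most 1 but can equal 1, so the decay must come from the polynomial factor 1 / k^2 in
  the tree count, which passes to forests through the exponential formula. At K = k the base exceeds
  1 / h^2, which is why losing (1 / h)^k in the tree count is harmless there. Induced subgraphs of
  trees need not be trees, whereas forests of bounded degree are hereditary; hence the upper bound
  is proved for forests and the lower bound for trees, and each serves both parameters.\<close>

lemma pair_in_vertex_pairs_iff [simp]: "{u, v} \<in> vertex_pairs V \<longleftrightarrow> u \<in> V \<and> v \<in> V \<and> u \<noteq> v"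
  by (auto simp: vertex_pairs_def card_2_iff doubleton_eq_iff card_insert_if)

lemma vertex_pairsE:
  assumes "e \<in> vertex_pairs V"
  obtains u v where "e = {u, v}" "u \<in> V" "v \<in> V" "u \<noteq> v"
  using assms by (auto simp: vertex_pairs_def card_2_iff)

lemma finite_vertex_pairs [simp]: "finite V \<Longrightarrow> finite (vertex_pairs V)"
  by (rule finite_subset[of _ "Pow V"]) (auto simp: vertex_pairs_def)

lemma card_vertex_pairs: "finite V \<Longrightarrow> card (vertex_pairs V) = card V choose 2"
  unfolding vertex_pairs_def by (rule n_subsets)

lemma vertex_pairs_mono: "V \<subseteq> W \<Longrightarrow> vertex_pairs V \<subseteq> vertex_pairs W"
  by (auto simp: vertex_pairs_def)

lemma vertex_pairs_Int: "vertex_pairs (V \<inter> W) = vertex_pairs V \<inter> vertex_pairs W"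
  by (auto simp: vertex_pairs_def)

lemma induced_edges_eq: "E \<subseteq> vertex_pairs V \<Longrightarrow> induced_edges E S = E \<inter> vertex_pairs S"
  by (auto simp: induced_edges_def vertex_pairs_def)

lemma forest_graph_mono: "forest_graph E \<Longrightarrow> E' \<subseteq> E \<Longrightarrow> forest_graph E'"
  unfolding forest_graph_def graph_cycle_def by blast

lemma graph_degree_mono: "finite E \<Longrightarrow> E' \<subseteq> E \<Longrightarrow> graph_degree E' v \<le> graph_degree E v"
  unfolding graph_degree_def by (intro card_mono) auto

lemma max_degree_le_mono:
  "max_degree_le V E \<Delta> \<Longrightarrow> finite E \<Longrightarrow> E' \<subseteq> E \<Longrightarrow> V' \<subseteq> V \<Longrightarrow> max_degree_le V' E' \<Delta>"
  unfolding max_degree_le_def by (meson graph_degree_mono order_trans subsetD)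

text \<open>A new cycle would have to pass through \<open>v\<close>, and the two cycle edges there
  lead to different vertices, but \<open>{u, v}\<close> is the only edge at
  \<open>v\<close>.\<close>

lemma forest_insert_leaf:
  assumes forest: "forest_graph E" and v: "v \<notin> \<Union>E" and "u \<noteq> v"
  shows "forest_graph (insert {u, v} E)"
  unfolding forest_graph_def
proof
  assume "\<exists>xs. graph_cycle (insert {u, v} E) xs"
  then obtain xs where len: "3 \<le> length xs" and dist: "distinct xs"
    and edges: "\<And>i. i < length xs \<Longrightarrow> {xs ! i, xs ! (Suc i mod length xs)} \<in> insert {u, v} E"
    by (auto simp: graph_cycle_def)
  have "v \<in> set xs"
  proof (rule ccontr)
    assume no: "v \<notin> set xs"
    have "{xs ! i, xs ! (Suc i mod length xs)} \<in> E" if i: "i < length xs" for i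
    proof -
      have "Suc i mod length xs < length xs" using len by (intro mod_less_divisor) linarith
      then have "v \<notin> {xs ! i, xs ! (Suc i mod length xs)}" using no i nth_mem by blast
      then show ?thesis using edges[OF i] by auto
    qed
    then have "graph_cycle E xs" using len dist by (auto simp: graph_cycle_def)
    then show False using forest by (auto simp: forest_graph_def)
  qed
  then obtain i where i: "i < length xs" "xs ! i = v" by (auto simp: in_set_conv_nth)
  define n where "n = length xs"
  \<comment> \<open>\<open>j\<close> and \<open>h\<close> are the cyclic successor and predecessor
    of position \<open>i\<close>; they differ because the cycle has length at least 3.\<close>
  define j where "j = (if i = n - 1 then 0 else Suc i)"
  define h where "h = (if i = 0 then n - 1 else i - 1)"
  have n: "3 \<le> n" "i < n" using i len by (simp_all add: n_def)
  have jn: "j < n" "Suc i mod n = j" using n by (auto simp: j_def)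
  have hn: "h < n" "Suc h mod n = i" using n by (auto simp: h_def)
  have "h \<noteq> j" using n by (auto simp: h_def j_def)
  have "{v, xs ! j} \<in> insert {u, v} E"
    using edges[of i] jn(2) i unfolding n_def by metis
  moreover have "{xs ! h, v} \<in> insert {u, v} E"
    using edges[of h] hn i unfolding n_def by metis
  moreover have "{v, xs ! j} \<notin> E" "{xs ! h, v} \<notin> E" using v by blast+
  ultimately have "{v, xs ! j} = {u, v}" "{xs ! h, v} = {u, v}" by simp_all
  then have "xs ! j = u" "xs ! h = u" using \<open>u \<noteq> v\<close> by (simp_all add: doubleton_eq_iff)
  then show False using dist jn hn \<open>h \<noteq> j\<close> by (auto simp: nth_eq_iff_index_eq n_def)
qed

text \<open>An end of a longest path is a leaf.\<close>
lemma forest_has_leaf: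
  assumes fin: "finite V" and E: "E \<subseteq> vertex_pairs V" and forest: "forest_graph E" and "E \<noteq> {}"
  obtains v where "v \<in> V" "graph_degree E v = 1"
proof -
  define P where "P = {xs. set xs \<subseteq> V \<and> distinct xs \<and> 2 \<le> length xs \<and>
    (\<forall>i. Suc i < length xs \<longrightarrow> {xs ! i, xs ! Suc i} \<in> E)}"
  have "finite P"
    by (rule finite_subset[OF _ finite_subset_distinct[OF fin]]) (auto simp: P_def)
  moreover obtain e where "e \<in> E" using \<open>E \<noteq> {}\<close> by blast
  then obtain a b where "{a, b} \<in> E" "a \<in> V" "b \<in> V" "a \<noteq> b" using E by (metis subsetD vertex_pairsE)
  then have "[a, b] \<in> P" by (auto simp: P_def less_Suc_eq)
  ultimately obtain xs where xs: "xs \<in> P" and longest: "\<And>ys. ys \<in> P \<Longrightarrow> length ys \<le> length xs"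
    using Max_in[of "length ` P"] Max_ge[of "length ` P"] by fastforce
  then obtain x y zs where xs_eq: "xs = x # y # zs"
    by (cases xs; cases "tl xs") (auto simp: P_def)
  have xV: "x \<in> V" and path: "\<And>i. Suc i < length xs \<Longrightarrow> {xs ! i, xs ! Suc i} \<in> E"
    and dist: "distinct xs" and sub: "set xs \<subseteq> V"
    using xs by (auto simp: P_def xs_eq)
  have xy: "{x, y} \<in> E" using path[of 0] by (simp add: xs_eq)
  have "e = {x, y}" if e: "e \<in> E" "x \<in> e" for e
  proof (rule ccontr)
    assume ne: "e \<noteq> {x, y}"
    obtain z where z: "e = {x, z}" "z \<in> V" "z \<noteq> x"
      using e E by (auto elim!: vertex_pairsE dest!: subsetD)
    \<comment> \<open>A second neighbour \<open>z\<close> of the end \<open>x\<close> either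
      prolongs the longest path or, lying on it, closes a cycle with the segment from
      \<open>x\<close> to \<open>z\<close>.\<close>
    show False
    proof (cases "z \<in> set xs")
      case False
      have "{(z # xs) ! i, (z # xs) ! Suc i} \<in> E" if "Suc i < length (z # xs)" for i
      proof (cases i)
        case 0
        then show ?thesis using e z by (simp add: xs_eq insert_commute)
      next
        case (Suc m)
        then show ?thesis using path[of m] that by simp
      qed
      then have "z # xs \<in> P" using False z xs by (auto simp: P_def)
      then show False using longest by force
    next
      case True
      then obtain i where i: "i < length xs" "xs ! i = z" by (auto simp: in_set_conv_nth)
      have i2: "2 \<le> i"
        using i z ne by (cases i; cases "i - 1") (auto simp: xs_eq)
      have "graph_cycle E (take (Suc i) xs)"
        unfolding graph_cycle_def
      proof (intro conjI allI impI)
        show "3 \<le> length (take (Suc i) xs)" using i i2 by simp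
        show "distinct (take (Suc i) xs)" using dist by simp
        fix m assume m: "m < length (take (Suc i) xs)"
        show "{take (Suc i) xs ! m, take (Suc i) xs ! (Suc m mod length (take (Suc i) xs))} \<in> E"
        proof (cases "m = i")
          case True
          have "length (take (Suc i) xs) = Suc i" using i by simp
          moreover have "xs ! 0 = x" by (simp add: xs_eq)
          ultimately show ?thesis using True i z e by (simp add: insert_commute)
        next
          case False
          then have "m < i" "length (take (Suc i) xs) = Suc i" using m i by simp_all
          then show ?thesis using path[of m] i by simp
        qed
      qed
      then show False using forest by (auto simp: forest_graph_def)
    qed
  qed
  then have "{e \<in> E. x \<in> e} = {{x, y}}" using xy by blast
  then have "graph_degree E x = 1" by (simp add: graph_degree_def)
  then show ?thesis using that xV by blast
qed

lemma connected_insert_leaf: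
  assumes "u \<in> V" "connected_graph V E"
  shows "connected_graph (insert v V) (insert {u, v} E)"
proof -
  let ?R = "{(x, y). {x, y} \<in> E}" and ?R' = "{(x, y). {x, y} \<in> insert {u, v} E}"
  have mono: "?R\<^sup>* \<subseteq> ?R'\<^sup>*" by (rule rtrancl_mono) auto
  have uv: "(u, v) \<in> ?R'\<^sup>*" "(v, u) \<in> ?R'\<^sup>*" by (auto simp: insert_commute)
  have "(x, u) \<in> ?R'\<^sup>*" "(u, x) \<in> ?R'\<^sup>*" if "x \<in> insert v V" for x
    using that assms uv mono by (auto simp: connected_graph_def)
  then show ?thesis by (auto simp: connected_graph_def intro: rtrancl_trans)
qed

text \<open>Collapsing \<open>v\<close> onto its only neighbour \<open>u\<close> turns each walk
  into a walk that avoids \<open>v\<close>; this is the \<open>if\<close> in the induction claim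
  \<open>reach\<close>.\<close>

lemma connected_remove_leaf:
  assumes conn: "connected_graph V (insert {u, v} E)" and "v \<notin> \<Union>E" "u \<in> V" "u \<noteq> v"
  shows "connected_graph (V - {v}) E"
proof -
  let ?R = "{(x, y). {x, y} \<in> E}" and ?R' = "{(x, y). {x, y} \<in> insert {u, v} E}"
  have reach: "(x, if y = v then u else y) \<in> ?R\<^sup>*" if "(x, y) \<in> ?R'\<^sup>*" "x \<noteq> v" for x y
    using that
  proof (induction rule: rtrancl_induct)
    case base
    then show ?case by simp
  next
    case (step y z)
    show ?case
    proof (cases "{y, z} \<in> E")
      case True
      then have "y \<noteq> v" "z \<noteq> v" using assms(2) by auto
      then show ?thesis using step True by (auto intro: rtrancl_into_rtrancl)
    next
      case False
      then have "{y, z} = {u, v}" using step by simp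
      then show ?thesis using step assms(4) by (auto simp: doubleton_eq_iff split: if_splits)
    qed
  qed
  show ?thesis unfolding connected_graph_def
  proof (intro conjI ballI)
    show "V - {v} \<noteq> {}" using assms by auto
    fix x y assume "x \<in> V - {v}" "y \<in> V - {v}"
    then show "(x, y) \<in> ?R\<^sup>*"
      using reach[of x y] conn by (auto simp: connected_graph_def)
  qed
qed

text \<open>This equivalence drives the leaf recursion below, one direction for deleting a leaf and
  the other for attaching one.\<close>

lemma tree_insert_leaf_iff:
  assumes "E \<subseteq> vertex_pairs V" "u \<in> V" "v \<notin> V"
  shows "tree_graph (insert v V) (insert {u, v} E) \<longleftrightarrow> tree_graph V E"
proof -
  have v: "v \<notin> \<Union>E" using assms by (auto simp: vertex_pairs_def)
  have "u \<noteq> v" "insert v V - {v} = V" using assms by auto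
  then show ?thesis
    using forest_insert_leaf[OF _ v] connected_insert_leaf[of u V E v]
      connected_remove_leaf[of "insert v V" u v E] v assms(2) forest_graph_mono[of "insert {u, v} E" E]
    unfolding tree_graph_def by auto
qed

lemma connected_graph_degree_pos:
  assumes fin: "finite V" and E: "E \<subseteq> vertex_pairs V" and conn: "connected_graph V E"
    and "2 \<le> card V" "v \<in> V"
  shows "1 \<le> graph_degree E v"
proof -
  have "\<exists>w\<in>V. w \<noteq> v"
  proof (rule ccontr)
    assume "\<not> ?thesis"
    then have "V \<subseteq> {v}" by auto
    then have "card V \<le> 1" by (metis card.empty card_insert_disjoint card_mono finite.emptyI finite.insertI insert_absorb insert_not_empty One_nat_def)
    then show False using assms by simp
  qed
  then obtain w where "w \<in> V" "w \<noteq> v" by blast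
  then have "(v, w) \<in> {(x, y). {x, y} \<in> E}\<^sup>*" using conn assms by (auto simp: connected_graph_def)
  then obtain z where "{v, z} \<in> E" using \<open>w \<noteq> v\<close> by (auto elim: converse_rtranclE)
  then have "{v, z} \<in> {e \<in> E. v \<in> e}" by auto
  moreover have "finite {e \<in> E. v \<in> e}" using E fin finite_subset by fastforce
  ultimately show ?thesis unfolding graph_degree_def by (metis One_nat_def Suc_leI card_gt_0_iff empty_iff)
qed

lemma graph_degree_insert:
  assumes "finite E" "e \<notin> E"
  shows "graph_degree (insert e E) v = graph_degree E v + (if v \<in> e then 1 else 0)"
proof -
  have "{f \<in> insert e E. v \<in> f} = (if v \<in> e then insert e {f \<in> E. v \<in> f} else {f \<in> E. v \<in> f})" by auto
  then show ?thesis using assms by (auto simp: graph_degree_def)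
qed

section \<open>Counting trees by degrees\<close>

text \<open>\<open>d\<close> holds degrees minus one, so a leaf is a zero of \<open>d\<close>, and
  on a tree with k \<ge> 2 vertices the values of \<open>d\<close> sum to k - 2.\<close>

definition trees_with_degrees :: "'a set \<Rightarrow> ('a \<Rightarrow> nat) \<Rightarrow> 'a set set set" where
  "trees_with_degrees V d =
     {E. E \<subseteq> vertex_pairs V \<and> tree_graph V E \<and> (\<forall>v\<in>V. graph_degree E v = Suc (d v))}"

lemma finite_trees_with_degrees [simp]: "finite V \<Longrightarrow> finite (trees_with_degrees V d)"
  by (rule finite_subset[of _ "Pow (vertex_pairs V)"]) (auto simp: trees_with_degrees_def)

text \<open>Deleting the leaf \<open>v\<close> costs its neighbour \<open>u\<close> one degree. With
  at least two vertices in \<open>V\<close> the neighbour keeps positive degree, which is what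
  \<open>0 < d u\<close> expresses.\<close>

lemma trees_with_degrees_insert_leaf:
  assumes fin: "finite V" and v: "v \<notin> V" "d v = 0" and card: "2 \<le> card V"
  shows "trees_with_degrees (insert v V) d =
    (\<Union>u\<in>{u \<in> V. 0 < d u}. insert {u, v} ` trees_with_degrees V (d(u := d u - 1)))"
proof (intro equalityI subsetI)
  fix E assume "E \<in> trees_with_degrees (insert v V) d"
  then have E: "E \<subseteq> vertex_pairs (insert v V)" and tree: "tree_graph (insert v V) E"
    and deg: "\<And>w. w \<in> insert v V \<Longrightarrow> graph_degree E w = Suc (d w)"
    by (auto simp: trees_with_degrees_def)
  have "card {e \<in> E. v \<in> e} = 1" using deg[of v] v by (simp add: graph_degree_def)
  then obtain e where e: "{e \<in> E. v \<in> e} = {e}" by (auto simp: card_1_singleton_iff)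
  then have "e \<in> E" "v \<in> e" by blast+
  obtain x y where xy: "e = {x, y}" "x \<in> insert v V" "y \<in> insert v V" "x \<noteq> y"
    using E \<open>e \<in> E\<close> by (blast elim: vertex_pairsE)
  obtain u where u: "e = {u, v}" "u \<in> insert v V" "u \<noteq> v"
  proof (cases "x = v")
    case True
    then show ?thesis using that[of y] xy by (simp add: insert_commute)
  next
    case False
    then show ?thesis using that[of x] xy \<open>v \<in> e\<close> by simp
  qed
  have uV: "u \<in> V" using u by simp
  define E' where "E' = E - {{u, v}}"
  have E_eq: "E = insert {u, v} E'" using \<open>e \<in> E\<close> u by (auto simp: E'_def)
  have "f \<subseteq> V" if "f \<in> E'" for f
  proof -
    have "v \<notin> f" using that e u by (auto simp: E'_def)
    moreover have "f \<subseteq> insert v V" using that E by (auto simp: E'_def vertex_pairs_def)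
    ultimately show ?thesis by blast
  qed
  then have E': "E' \<subseteq> vertex_pairs V" using E by (auto simp: E'_def vertex_pairs_def)
  have finE': "finite E'" using E' fin finite_subset finite_vertex_pairs by blast
  have tree': "tree_graph V E'"
    using tree tree_insert_leaf_iff[OF E' uV v(1)] by (simp add: E_eq)
  have deg_E: "graph_degree E w = graph_degree E' w + (if w \<in> {u, v} then 1 else 0)" for w
    unfolding E_eq by (rule graph_degree_insert[OF finE']) (simp add: E'_def)
  have "1 \<le> graph_degree E' u"
    using connected_graph_degree_pos[OF fin E' _ card uV] tree' by (simp add: tree_graph_def)
  then have "0 < d u" using deg[of u] deg_E[of u] uV by simp
  moreover have "graph_degree E' w = Suc ((d(u := d u - 1)) w)" if "w \<in> V" for w
    using deg[of w] deg_E[of w] that v \<open>0 < d u\<close> by (auto split: if_splits)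
  then have "E' \<in> trees_with_degrees V (d(u := d u - 1))"
    using E' tree' by (auto simp: trees_with_degrees_def)
  ultimately show "E \<in> (\<Union>u\<in>{u \<in> V. 0 < d u}. insert {u, v} ` trees_with_degrees V (d(u := d u - 1)))"
    using uV E_eq by blast
next
  fix E assume "E \<in> (\<Union>u\<in>{u \<in> V. 0 < d u}. insert {u, v} ` trees_with_degrees V (d(u := d u - 1)))"
  then obtain u E' where u: "u \<in> V" "0 < d u" and E_eq: "E = insert {u, v} E'"
    and E'_mem: "E' \<in> trees_with_degrees V (d(u := d u - 1))" by auto
  have E': "E' \<subseteq> vertex_pairs V" "tree_graph V E'"
    and deg: "\<And>w. w \<in> V \<Longrightarrow> graph_degree E' w = Suc ((d(u := d u - 1)) w)"
    using E'_mem by (auto simp: trees_with_degrees_def)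
  have finE': "finite E'" using E' fin finite_subset finite_vertex_pairs by blast
  have "{u, v} \<notin> E'" using E'(1) v(1) by (auto dest: subsetD)
  then have deg_E: "graph_degree E w = graph_degree E' w + (if w \<in> {u, v} then 1 else 0)" for w
    unfolding E_eq by (intro graph_degree_insert[OF finE'])
  have "{e \<in> E'. v \<in> e} = {}" using E'(1) v(1) by (auto simp: vertex_pairs_def)
  then have "graph_degree E' v = 0" by (simp only: graph_degree_def card.empty)
  then have "graph_degree E w = Suc (d w)" if "w \<in> insert v V" for w
    using deg[of w] deg_E[of w] that u v by (auto split: if_splits)
  moreover have "tree_graph (insert v V) E"
    unfolding E_eq using tree_insert_leaf_iff[OF E'(1) u(1) v(1)] E'(2) by blast
  moreover have "E \<subseteq> vertex_pairs (insert v V)"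
    unfolding E_eq using E'(1) vertex_pairs_mono[of V "insert v V"] u v by fastforce
  ultimately show "E \<in> trees_with_degrees (insert v V) d" by (auto simp: trees_with_degrees_def)
qed

text \<open>The unique edge at \<open>v\<close> reveals \<open>u\<close>, so the union over
  \<open>u\<close> is disjoint, and inserting that edge is injective because it is new.\<close>

lemma card_trees_with_degrees_insert_leaf:
  assumes fin: "finite V" and v: "v \<notin> V" "d v = 0" and card: "2 \<le> card V"
  shows "card (trees_with_degrees (insert v V) d) =
    (\<Sum>u | u \<in> V \<and> 0 < d u. card (trees_with_degrees V (d(u := d u - 1))))"
proof -
  have notin: "{u, v} \<notin> E" if "E \<in> trees_with_degrees V d'" for u E d'
    using that v(1) by (auto simp: trees_with_degrees_def dest: subsetD)
  have inj: "inj_on (insert {u, v}) (trees_with_degrees V d')" for u d'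
    by (rule inj_onI) (metis insert_ident notin)
  have ne: "insert {u, v} E \<noteq> insert {w, v} E'"
    if "u \<noteq> w" "w \<noteq> v" "u \<noteq> v" "E \<in> trees_with_degrees V d'" "E' \<in> trees_with_degrees V d''" for u w E E' d' d''
  proof
    assume "insert {u, v} E = insert {w, v} E'"
    then have "{u, v} = {w, v}" using notin[OF that(5), of u] by blast
    then show False using that by (simp add: doubleton_eq_iff)
  qed
  have disj: "(insert {u, v} ` trees_with_degrees V d') \<inter> (insert {w, v} ` trees_with_degrees V d'') = {}"
    if "u \<in> V" "w \<in> V" "u \<noteq> w" for u w d' d''
  proof -
    have "w \<noteq> v" "u \<noteq> v" using that v(1) by auto
    then have "x \<noteq> y" if "x \<in> insert {u, v} ` trees_with_degrees V d'"
      "y \<in> insert {w, v} ` trees_with_degrees V d''" for x y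
      using that ne[OF \<open>u \<noteq> w\<close>] by (elim imageE) simp
    then show ?thesis by blast
  qed
  have "card (trees_with_degrees (insert v V) d) =
      (\<Sum>u | u \<in> V \<and> 0 < d u. card (insert {u, v} ` trees_with_degrees V (d(u := d u - 1))))"
    unfolding trees_with_degrees_insert_leaf[of V v d, OF assms]
  proof (rule card_UN_disjoint)
    show "finite {u \<in> V. 0 < d u}" using fin by simp
    show "\<forall>u\<in>{u \<in> V. 0 < d u}. finite (insert {u, v} ` trees_with_degrees V (d(u := d u - 1)))"
      using fin by simp
  qed (intro ballI impI, rule disj, simp_all)
  then show ?thesis by (simp add: card_image[OF inj])
qed

lemma tree_graph_singleton: "tree_graph {a} {}"
  by (auto simp: tree_graph_def connected_graph_def forest_graph_def graph_cycle_def intro!: exI[of _ 0])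

lemma vertex_pairs_singleton: "vertex_pairs {a} = {}"
  by (auto elim!: vertex_pairsE)

lemma trees_with_degrees_doubleton:
  assumes "a \<noteq> b"
  shows "trees_with_degrees {a, b} d = (if d a = 0 \<and> d b = 0 then {{{a, b}}} else {})"
proof -
  have vp: "vertex_pairs {a, b} = {{a, b}}"
    using assms by (auto elim!: vertex_pairsE)
  have "\<not> connected_graph {a, b} {}"
    using assms by (auto simp: connected_graph_def)
  moreover have "tree_graph {a, b} {{a, b}}"
    using tree_insert_leaf_iff[of "{}" "{a}" a b] tree_graph_singleton[of a] assms
    by (simp add: insert_commute)
  moreover have "graph_degree {{a, b}} a = 1" "graph_degree {{a, b}} b = 1"
    by (simp_all add: graph_degree_def card_1_singleton_iff) blast+
  moreover have "E \<subseteq> {{a, b}} \<longleftrightarrow> E = {} \<or> E = {{a, b}}" for E by blast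
  ultimately have "E \<subseteq> {{a, b}} \<and> tree_graph {a, b} E \<and> (\<forall>v\<in>{a, b}. graph_degree E v = Suc (d v)) \<longleftrightarrow>
      E = {{a, b}} \<and> d a = 0 \<and> d b = 0" for E
    by (cases "E = {{a, b}}") (auto simp: tree_graph_def)
  then show ?thesis
    unfolding trees_with_degrees_def vp by simp
qed

text \<open>Induction on the number of vertices by the leaf recursion, in place of a bijection with
  Pruefer codes. Decrementing \<open>d u\<close> divides the product of factorials by
  \<open>d u\<close>, so the recursion sums (n - 2)! \<open>d u\<close> / \<open>P\<close> over
  \<open>u\<close>, and the sum of \<open>d\<close> supplies the missing factor n - 1.\<close>

theorem card_trees_with_degrees:
  assumes "finite V" "2 \<le> card V"
  shows "real (card (trees_with_degrees V d)) =
    (if sum d V = card V - 2 then fact (card V - 2) / (\<Prod>v\<in>V. fact (d v)) else 0)"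
proof -
  obtain m where "card V = m + 2" using assms(2) by (metis le_Suc_ex add.commute)
  then show ?thesis using assms(1)
  proof (induction m arbitrary: V d)
    case 0
    then obtain a b where "V = {a, b}" "a \<noteq> b" by (metis card_2_iff add_0)
    then show ?case by (auto simp: trees_with_degrees_doubleton)
  next
    case (Suc m)
    define n where "n = m + 2"
    have IH: "real (card (trees_with_degrees U d)) =
        (if sum d U = n - 2 then fact (n - 2) / (\<Prod>v\<in>U. fact (d v)) else 0)"
      if "card U = n" "finite U" for U and d :: "'a \<Rightarrow> nat"
      using Suc.IH[of U d] that by (simp add: n_def)
    have card: "card V = Suc n" "finite V" "2 \<le> n" using Suc.prems by (simp_all add: n_def)
    show ?case
    proof (cases "\<exists>v\<in>V. d v = 0")
      case True
      then obtain v where v: "v \<in> V" "d v = 0" by blast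
      define U where "U = V - {v}"
      have V: "V = insert v U" "v \<notin> U" "finite U" "card U = n"
        using v card by (auto simp: U_def)
      have sumV: "sum d V = sum d U" and prodV: "(\<Prod>w\<in>V. fact (d w)) = (\<Prod>w\<in>U. fact (d w) :: real)"
        using V v by simp_all
      define P where "P = (\<Prod>w\<in>U. fact (d w) :: real)"
      have P: "P > 0" unfolding P_def by (intro prod_pos) simp
      have term_eq: "real (card (trees_with_degrees U (d(u := d u - 1)))) =
        (if sum d U = n - 1 then fact (n - 2) / P * real (d u) else 0)" if u: "u \<in> U" "0 < d u" for u
      proof -
        have "sum (d(u := d u - 1)) U = (d u - 1) + sum d (U - {u})"
          using V u by (subst sum.remove[of _ u]) (auto intro!: sum.cong)
        moreover have "sum d U = d u + sum d (U - {u})" using V u by (subst sum.remove[of _ u]) auto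
        ultimately have "sum (d(u := d u - 1)) U = n - 2 \<longleftrightarrow> sum d U = n - 1" using u card by auto
        moreover have "P = fact (d u) * (\<Prod>w\<in>U - {u}. fact (d w))"
          unfolding P_def using V u by (subst prod.remove[of _ u]) auto
        moreover have "(\<Prod>w\<in>U. fact ((d(u := d u - 1)) w)) = fact (d u - 1) * (\<Prod>w\<in>U - {u}. fact (d w) :: real)"
          using V u by (subst prod.remove[of _ u]) (auto intro!: prod.cong)
        moreover have "fact (d u) = real (d u) * fact (d u - 1)" using u by (subst fact_reduce) auto
        ultimately show ?thesis
          using IH[of U "d(u := d u - 1)"] V u by (simp add: field_simps)
      qed
      have "real (card (trees_with_degrees V d)) =
        (\<Sum>u | u \<in> U \<and> 0 < d u. if sum d U = n - 1 then fact (n - 2) / P * real (d u) else 0)"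
        unfolding V(1) using card_trees_with_degrees_insert_leaf[of U v d] V(2-4) v(2) card term_eq
        by (simp del: fun_upd_apply)
      also have "\<dots> = (if sum d U = n - 1 then fact (n - 2) / P * (\<Sum>u | u \<in> U \<and> 0 < d u. real (d u)) else 0)"
        by (simp add: sum_distrib_left)
      also have "(\<Sum>u | u \<in> U \<and> 0 < d u. real (d u)) = real (sum d U)"
        unfolding of_nat_sum using V by (intro sum.mono_neutral_left) auto
      finally have "real (card (trees_with_degrees V d)) = (if sum d U = n - 1 then fact (n - 2) / P * real (n - 1) else 0)"
        by simp
      moreover have "(fact (n - 1) :: real) = real (n - 1) * fact (n - 2)"
        using card by (subst fact_reduce) (auto simp: numeral_2_eq_2)
      moreover have "card V - 2 = n - 1" using card by simp
      ultimately show ?thesis unfolding sumV prodV P_def[symmetric] by simp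
    next
      \<comment> \<open>Without a leaf both sides are 0: a forest with an edge has a vertex of
        degree 1, and \<open>d\<close> being at least 1 everywhere makes its sum too large.\<close>
      case False
      then have pos: "1 \<le> d v" if "v \<in> V" for v using that by (metis less_one not_le)
      have "trees_with_degrees V d = {}"
      proof (rule ccontr)
        assume "trees_with_degrees V d \<noteq> {}"
        then obtain E where E: "E \<subseteq> vertex_pairs V" "tree_graph V E"
          "\<And>v. v \<in> V \<Longrightarrow> graph_degree E v = Suc (d v)" by (auto simp: trees_with_degrees_def)
        have "V \<noteq> {}" using card by auto
        then have "E \<noteq> {}" using E(3) by (auto simp: graph_degree_def)
        then show False
          using forest_has_leaf[OF card(2) E(1)] E(2,3) False by (metis One_nat_def Suc_inject tree_graph_def)
      qed
      moreover have "sum d V \<ge> sum (\<lambda>_. 1) V" by (intro sum_mono pos)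
      then have "sum d V \<noteq> card V - 2" using card by auto
      ultimately show ?thesis by simp
    qed
  qed
qed

lemma handshake:
  assumes "finite V" "E \<subseteq> vertex_pairs V"
  shows "(\<Sum>v\<in>V. graph_degree E v) = 2 * card E"
  unfolding graph_degree_def
proof (rule sum_multicount)
  show "finite E" using assms finite_subset finite_vertex_pairs by blast
  show "\<forall>e\<in>E. card {v \<in> V. v \<in> e} = 2"
  proof
    fix e assume "e \<in> E"
    then have "{v \<in> V. v \<in> e} = e" "card e = 2" using assms by (auto simp: vertex_pairs_def)
    then show "card {v \<in> V. v \<in> e} = 2" by simp
  qed
qed (use assms in auto)

text \<open>Read off the degree formula: a class \<open>trees_with_degrees V d\<close> that contains
  a tree has positive count, which forces the sum of \<open>d\<close> to be
  \<open>card V - 2\<close>. The handshake identity turns this into a number of edges.\<close>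

lemma card_tree_edges:
  assumes "finite V" "E \<subseteq> vertex_pairs V" "tree_graph V E"
  shows "card E + 1 = card V"
proof (cases "2 \<le> card V")
  case True
  define d where "d v = graph_degree E v - 1" for v
  have deg: "graph_degree E v = Suc (d v)" if "v \<in> V" for v
    using connected_graph_degree_pos[OF assms(1,2) _ True that] assms(3) by (auto simp: d_def tree_graph_def)
  then have "E \<in> trees_with_degrees V d" using assms by (auto simp: trees_with_degrees_def)
  then have "card (trees_with_degrees V d) \<noteq> 0" using assms(1) by (auto simp: card_eq_0_iff)
  then have "sum d V = card V - 2"
    using card_trees_with_degrees[OF assms(1) True, of d] by (auto split: if_splits)
  moreover have "2 * card E = sum d V + card V"
    unfolding handshake[OF assms(1,2), symmetric] by (simp add: deg sum_Suc)
  ultimately show ?thesis using True by simp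
next
  case False
  moreover have "card V \<noteq> 0" using assms by (auto simp: tree_graph_def connected_graph_def)
  ultimately have "card V = 1" by simp
  then obtain a where "V = {a}" by (auto simp: card_1_singleton_iff)
  then show ?thesis using assms by (simp add: vertex_pairs_singleton)
qed

section \<open>Generating polynomial of trees of bounded degree\<close>

definition bounded_trees :: "nat \<Rightarrow> 'a set \<Rightarrow> 'a set set set" where
  "bounded_trees \<Delta> V = {E. E \<subseteq> vertex_pairs V \<and> tree_graph V E \<and> max_degree_le V E \<Delta>}"

lemma finite_bounded_trees [simp]: "finite V \<Longrightarrow> finite (bounded_trees \<Delta> V)"
  by (rule finite_subset[of _ "Pow (vertex_pairs V)"]) (auto simp: bounded_trees_def)

text \<open>Functions in the extensional product are fixed outside \<open>V\<close>, so a tree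
  determines its \<open>d\<close> and the union can later be counted as a disjoint one.\<close>

lemma bounded_trees_eq_UN:
  assumes "finite V" "2 \<le> card V"
  shows "bounded_trees \<Delta> V = (\<Union>d\<in>V \<rightarrow>\<^sub>E {..<\<Delta>}. trees_with_degrees V d)"
proof (intro equalityI subsetI)
  fix E assume "E \<in> bounded_trees \<Delta> V"
  then have E: "E \<subseteq> vertex_pairs V" "tree_graph V E" "max_degree_le V E \<Delta>" by (auto simp: bounded_trees_def)
  define d where "d = (\<lambda>v\<in>V. graph_degree E v - 1)"
  have pos: "1 \<le> graph_degree E v" if "v \<in> V" for v
    using connected_graph_degree_pos[OF assms(1) E(1) _ assms(2) that] E(2) by (auto simp: tree_graph_def)
  then have "d \<in> V \<rightarrow>\<^sub>E {..<\<Delta>}" using E(3) by (fastforce simp: d_def max_degree_le_def)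
  moreover have "E \<in> trees_with_degrees V d"
    using E pos by (force simp: trees_with_degrees_def d_def)
  ultimately show "E \<in> (\<Union>d\<in>V \<rightarrow>\<^sub>E {..<\<Delta>}. trees_with_degrees V d)" by blast
next
  fix E assume "E \<in> (\<Union>d\<in>V \<rightarrow>\<^sub>E {..<\<Delta>}. trees_with_degrees V d)"
  then show "E \<in> bounded_trees \<Delta> V"
    by (fastforce simp: bounded_trees_def trees_with_degrees_def max_degree_le_def PiE_iff)
qed

text \<open>\<open>gamma_trunc\<close> as a formal polynomial, so that coefficients can be extracted
  and \<open>pderiv\<close> lowers the index by one. The range \<open>j < \<Delta>\<close> avoids
  the truncated \<open>\<Delta> - 1\<close>; the two agree for \<Delta> \<ge> 1.\<close>

definition trunc_exp_poly :: "nat \<Rightarrow> real poly" where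
  "trunc_exp_poly \<Delta> = (\<Sum>j<\<Delta>. monom (1 / fact j) j)"

lemma monom_prod: "(\<Prod>v\<in>V. monom (c v) (d v)) = monom (\<Prod>v\<in>V. c v) (\<Sum>v\<in>V. d v)"
  by (induction V rule: infinite_finite_induct) (auto simp: mult_monom)

lemma coeff_trunc_exp_poly_power:
  assumes "finite V"
  shows "coeff (trunc_exp_poly \<Delta> ^ card V) m =
    (\<Sum>d\<in>V \<rightarrow>\<^sub>E {..<\<Delta>}. if sum d V = m then 1 / (\<Prod>v\<in>V. fact (d v)) else 0)"
proof -
  have "trunc_exp_poly \<Delta> ^ card V = (\<Prod>v\<in>V. \<Sum>j<\<Delta>. monom (1 / fact j) j)"
    by (simp add: trunc_exp_poly_def)
  also have "\<dots> = (\<Sum>d\<in>V \<rightarrow>\<^sub>E {..<\<Delta>}. \<Prod>v\<in>V. monom (1 / fact (d v)) (d v))"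
    using assms by (subst prod_sum_PiE) auto
  also have "\<dots> = (\<Sum>d\<in>V \<rightarrow>\<^sub>E {..<\<Delta>}. monom (1 / (\<Prod>v\<in>V. fact (d v))) (sum d V))"
    by (simp add: monom_prod prod_dividef)
  finally show ?thesis by (simp add: coeff_sum)
qed

text \<open>Degrees minus one are the multiplicities in the Pruefer code, whence the power of the truncated
  exponential polynomial.\<close>
theorem card_bounded_trees:
  assumes "finite V" "2 \<le> card V"
  shows "real (card (bounded_trees \<Delta> V)) =
    fact (card V - 2) * coeff (trunc_exp_poly \<Delta> ^ card V) (card V - 2)"
proof -
  have disj: "trees_with_degrees V d \<inter> trees_with_degrees V d' = {}"
    if "d \<in> V \<rightarrow>\<^sub>E {..<\<Delta>}" "d' \<in> V \<rightarrow>\<^sub>E {..<\<Delta>}" "d \<noteq> d'" for d d'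
  proof (rule ccontr)
    assume "\<not> ?thesis"
    then have "\<And>v. v \<in> V \<Longrightarrow> d v = d' v" by (fastforce simp: trees_with_degrees_def)
    then have "d = d'" using that(1,2) by (intro PiE_ext)
    then show False using that(3) by simp
  qed
  have "card (bounded_trees \<Delta> V) = (\<Sum>d\<in>V \<rightarrow>\<^sub>E {..<\<Delta>}. card (trees_with_degrees V d))"
    unfolding bounded_trees_eq_UN[OF assms] using assms(1) disj
    by (subst card_UN_disjoint) (auto intro: finite_PiE)
  then have "real (card (bounded_trees \<Delta> V)) = (\<Sum>d\<in>V \<rightarrow>\<^sub>E {..<\<Delta>}.
      if sum d V = card V - 2 then fact (card V - 2) / (\<Prod>v\<in>V. fact (d v)) else 0)"
    by (simp add: card_trees_with_degrees[OF assms])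
  then show ?thesis
    unfolding coeff_trunc_exp_poly_power[OF assms(1)] by (simp add: sum_distrib_left if_distrib cong: if_cong)
qed

section \<open>Growth of the number of trees\<close>

lemma poly_trunc_exp_poly: "1 \<le> \<Delta> \<Longrightarrow> poly (trunc_exp_poly \<Delta>) x = gamma_trunc \<Delta> x"
  by (cases \<Delta>) (simp_all add: trunc_exp_poly_def gamma_trunc_def poly_sum poly_monom
      atLeast0AtMost lessThan_Suc_atMost)

lemma pderiv_sum: "pderiv (sum f A) = (\<Sum>x\<in>A. pderiv (f x))"
  using higher_pderiv_sum[of 1 f A] by simp

lemma pderiv_trunc_exp_poly: "pderiv (trunc_exp_poly (Suc D)) = trunc_exp_poly D"
  unfolding trunc_exp_poly_def sum.lessThan_Suc_shift
  by (simp add: pderiv_sum pderiv_monom pderiv_add field_simps flip: of_nat_Suc del: of_nat_Suc)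

lemma coeff_trunc_exp_poly: "coeff (trunc_exp_poly \<Delta>) j = (if j < \<Delta> then 1 / fact j else 0)"
  by (simp add: trunc_exp_poly_def coeff_sum)

text \<open>Clearing the denominator turns the equation into g(x) = 1 for a polynomial g with
  coefficients 1/k! - 1/(k+1)! \<ge> 0. It is increasing, g(1) telescopes to 1 - 1/D! < 1, and its
  quadratic term alone gives g(2) \<ge> 2.\<close>

lemma alpha_crit_exists_unique:
  assumes "3 \<le> \<Delta>"
  shows "\<exists>!x. 1 < x \<and> x * gamma_trunc (\<Delta> - 1) x / gamma_trunc \<Delta> x = 1"
proof -
  define D where "D = \<Delta> - 1"
  have D: "2 \<le> D" "\<Delta> = Suc D" using assms by (simp_all add: D_def)
  define c where "c k = 1 / fact k - 1 / (fact (Suc k) :: real)" for k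
  have c_nonneg: "0 \<le> c k" for k
    unfolding c_def using fact_mono[of k "Suc k", where ?'a = real] by (simp add: frac_le del: fact_Suc)
  define g where "g x = (\<Sum>k<D. c k * x ^ Suc k)" for x :: real
  have g_eq: "g x - 1 = x * gamma_trunc (\<Delta> - 1) x - gamma_trunc \<Delta> x" for x
  proof -
    have "gamma_trunc (\<Delta> - 1) x = (\<Sum>k<D. x ^ k / fact k)"
      using D by (simp add: poly_trunc_exp_poly[symmetric] trunc_exp_poly_def poly_sum poly_monom)
    moreover have "gamma_trunc \<Delta> x = (\<Sum>k<Suc D. x ^ k / fact k)"
      using D by (simp add: poly_trunc_exp_poly[symmetric] trunc_exp_poly_def poly_sum poly_monom)
    moreover have "\<dots> = 1 + (\<Sum>k<D. x ^ Suc k / fact (Suc k))"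
      by (subst sum.lessThan_Suc_shift) simp
    ultimately show ?thesis
      unfolding g_def c_def
      by (simp add: sum_distrib_left left_diff_distrib sum_subtractf del: fact_Suc)
  qed
  have pos: "0 < gamma_trunc \<Delta> x" if "0 < x" for x
    unfolding gamma_trunc_def using that by (intro sum_pos) auto
  have iff: "x * gamma_trunc (\<Delta> - 1) x / gamma_trunc \<Delta> x = 1 \<longleftrightarrow> g x = 1" if "1 < x" for x
    using pos[of x] g_eq[of x] that by (auto simp: field_simps)
  have strict: "g x < g y" if "0 < x" "x < y" for x y
    unfolding g_def
  proof (rule sum_strict_mono_ex1)
    show "\<forall>k\<in>{..<D}. c k * x ^ Suc k \<le> c k * y ^ Suc k"
      using that c_nonneg by (intro ballI mult_left_mono power_mono) auto
    \<comment> \<open>\<open>c 0 = 0\<close>, so strict growth comes from index 1, which is in range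
      because \<Delta> \<ge> 3.\<close>
    have "c 1 * x ^ Suc 1 < c 1 * y ^ Suc 1"
      using that by (intro mult_strict_left_mono power_strict_mono) (auto simp: c_def)
    then show "\<exists>k\<in>{..<D}. c k * x ^ Suc k < c k * y ^ Suc k"
      using D by (intro bexI[of _ 1]) auto
  qed simp
  have "g 1 = 1 - 1 / fact D"
    unfolding g_def c_def by (simp add: sum_lessThan_telescope'[of "\<lambda>k. 1 / fact k" D] del: fact_Suc)
  then have g1: "g 1 < 1" by simp
  have "g 2 = c 1 * 2 ^ Suc 1 + (\<Sum>k\<in>{..<D} - {1}. c k * 2 ^ Suc k)"
    unfolding g_def using D by (subst sum.remove[of _ 1]) auto
  moreover have "0 \<le> (\<Sum>k\<in>{..<D} - {1}. c k * 2 ^ Suc k)"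
    using c_nonneg by (intro sum_nonneg mult_nonneg_nonneg) auto
  ultimately have g2: "1 \<le> g 2" by (simp add: c_def)
  have "continuous_on {1..2} g" unfolding g_def by (intro continuous_intros)
  then obtain x where x: "1 \<le> x" "x \<le> 2" "g x = 1" using IVT'[of g 1 1 2] g1 g2 by auto
  have "x \<noteq> 1" using x(3) g1 by (metis less_irrefl)
  then have "1 < x" using x(1) by simp
  have uniq: "y = x" if "1 < y" "g y = 1" for y
  proof (rule ccontr)
    assume "y \<noteq> x"
    then consider "x < y" | "y < x" by linarith
    then show False using strict[of x y] strict[of y x] that x(3) \<open>1 < x\<close> by cases simp_all
  qed
  show ?thesis
  proof (rule ex1I[of _ x])
    show "1 < x \<and> x * gamma_trunc (\<Delta> - 1) x / gamma_trunc \<Delta> x = 1"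
      using iff[OF \<open>1 < x\<close>] x(3) \<open>1 < x\<close> by blast
    show "y = x" if "1 < y \<and> y * gamma_trunc (\<Delta> - 1) y / gamma_trunc \<Delta> y = 1" for y
      using that iff[of y] uniq[of y] by blast
  qed
qed

lemma alpha_crit:
  assumes "3 \<le> \<Delta>"
  shows "1 < alpha_crit \<Delta>"
    and "alpha_crit \<Delta> * gamma_trunc (\<Delta> - 1) (alpha_crit \<Delta>) = gamma_trunc \<Delta> (alpha_crit \<Delta>)"
proof -
  have *: "1 < alpha_crit \<Delta> \<and>
      alpha_crit \<Delta> * gamma_trunc (\<Delta> - 1) (alpha_crit \<Delta>) / gamma_trunc \<Delta> (alpha_crit \<Delta>) = 1"
    unfolding alpha_crit_def by (rule theI'[OF alpha_crit_exists_unique[OF assms]])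
  then show "1 < alpha_crit \<Delta>" by simp
  \<comment> \<open>A vanishing denominator would give the quotient 0 instead of 1, so the equation
    can be multiplied out.\<close>
  from * show "alpha_crit \<Delta> * gamma_trunc (\<Delta> - 1) (alpha_crit \<Delta>) = gamma_trunc \<Delta> (alpha_crit \<Delta>)"
    by (metis div_0 div_by_0 eq_divide_eq_1 zero_neq_one)
qed

lemma a_crit_gt_1:
  assumes "3 \<le> \<Delta>"
  shows "1 < a_crit \<Delta>"
proof -
  have "(\<Sum>k\<in>{0, 1}. alpha_crit \<Delta> ^ k / fact k) \<le> a_crit \<Delta>"
    unfolding a_crit_def gamma_trunc_def using assms alpha_crit(1)[OF assms]
    by (intro sum_mono2) auto
  then show ?thesis using alpha_crit(1)[OF assms] by simp
qed

section \<open>Coefficients of polynomial powers at the critical point\<close>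

lemma coeff_power_nonneg:
  fixes p :: "'a :: linordered_idom poly"
  assumes "\<And>i. 0 \<le> coeff p i"
  shows "0 \<le> coeff (p ^ k) i"
  using assms by (induction k arbitrary: i) (auto simp: coeff_mult intro!: sum_nonneg mult_nonneg_nonneg)

lemma coeff_trunc_exp_poly_power_nonneg: "0 \<le> coeff (trunc_exp_poly \<Delta> ^ k) i"
  by (rule coeff_power_nonneg) (simp add: coeff_trunc_exp_poly)

text \<open>(m - c)^2 = m (m - 1) + (1 - 2 c) m + c^2, and the falling factorials are what
  derivatives produce.\<close>

lemma poly_second_moment:
  fixes p :: "real poly"
  assumes "degree p \<le> n"
  shows "(\<Sum>m\<le>n. coeff p m * x ^ m * (real m - c)\<^sup>2) =
    x\<^sup>2 * poly (pderiv (pderiv p)) x + (1 - 2 * c) * x * poly (pderiv p) x + c\<^sup>2 * poly p x"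
proof -
  define c' where "c' = coeff p"
  have p_eq: "p = (\<Sum>m\<le>n. monom (c' m) m)"
    using assms by (simp add: poly_as_sum_of_monoms' c'_def)
  have p0: "poly p x = (\<Sum>m\<le>n. c' m * x ^ m)"
    by (subst p_eq) (simp add: poly_sum poly_monom)
  have x1: "x * (real m * (c' m * x ^ (m - Suc 0))) = real m * (c' m * x ^ m)" for m by (cases m) auto
  have p1: "x * poly (pderiv p) x = (\<Sum>m\<le>n. c' m * x ^ m * real m)"
    by (subst p_eq) (simp add: pderiv_sum pderiv_monom poly_sum poly_monom sum_distrib_left
        x1 mult_ac)
  have x2: "real m * (c' m * (real (m - Suc 0) * (x\<^sup>2 * x ^ (m - Suc (Suc 0))))) =
      real m * (c' m * (x ^ m * (real m - 1)))" for m
    by (cases m; cases "m - 1") (auto simp: power2_eq_square)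
  have p2: "x\<^sup>2 * poly (pderiv (pderiv p)) x = (\<Sum>m\<le>n. c' m * (x ^ m * (real m * (real m - 1))))"
    by (subst p_eq) (simp add: pderiv_sum pderiv_monom poly_sum poly_monom sum_distrib_left
        x2 mult_ac)
  show ?thesis
    unfolding c'_def[symmetric] p0 p2 mult.assoc[of "1 - 2 * c"] p1
    by (simp add: sum_distrib_left flip: sum.distrib)
      (intro sum.cong refl, simp add: power2_eq_square algebra_simps)
qed

text \<open>Multiplying by \<open>poly p x\<close> restores the exponent \<open>k\<close>, so that k
  = 0 is no exception and no truncated k - 1 appears.\<close>

lemma pderiv_power_poly:
  fixes p :: "real poly"
  shows "poly (pderiv (p ^ k)) x * poly p x = poly p x ^ k * (real k * poly (pderiv p) x)"
proof (cases k)
  case (Suc n)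
  then show ?thesis unfolding Suc pderiv_power_Suc by (simp add: algebra_simps)
qed simp

lemma pderiv2_power_poly:
  fixes p :: "real poly"
  shows "poly (pderiv (pderiv (p ^ k))) x * (poly p x)\<^sup>2 =
    poly p x ^ k * (real k * poly p x * poly (pderiv (pderiv p)) x + real k * (real k - 1) * (poly (pderiv p) x)\<^sup>2)"
proof (cases k)
  case 0
  then show ?thesis by simp
next
  case (Suc n)
  have "poly (pderiv (pderiv (p ^ k))) x * (poly p x)\<^sup>2 =
      real (Suc n) * poly p x * (poly p x ^ n * poly p x * poly (pderiv (pderiv p)) x
        + (poly (pderiv (p ^ n)) x * poly p x) * poly (pderiv p) x)"
    unfolding Suc pderiv_power_Suc pderiv_mult pderiv_smult by (simp add: power2_eq_square algebra_simps)
  also have "\<dots> = real (Suc n) * poly p x * (poly p x ^ n * poly p x * poly (pderiv (pderiv p)) x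
        + (poly p x ^ n * (real n * poly (pderiv p) x)) * poly (pderiv p) x)"
    by (simp only: pderiv_power_poly)
  also have "\<dots> = poly p x ^ k * (real k * poly p x * poly (pderiv (pderiv p)) x + real k * (real k - 1) * (poly (pderiv p) x)\<^sup>2)"
    unfolding Suc by (simp add: power2_eq_square algebra_simps)
  finally show ?thesis .
qed

text \<open>Let j < \<Delta> have probability proportional to x^j / j!. At the critical x its mean x
  G' / G is 1, and then x^2 G'' / G is its variance.\<close>

definition trunc_exp_var :: "nat \<Rightarrow> real \<Rightarrow> real" where
  "trunc_exp_var \<Delta> x = x\<^sup>2 * poly (pderiv (pderiv (trunc_exp_poly \<Delta>))) x / poly (trunc_exp_poly \<Delta>) x"

text \<open>For nonnegative coefficients the normalised weights are those of a sum of
  \<open>k\<close> independent variables of mean 1, so the second moment about \<open>k\<close> is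
  \<open>k\<close> times a single variance.\<close>

lemma critical_second_moment:
  assumes crit: "x * poly (pderiv p) x = poly p x" and pos: "0 < poly p x"
    and "degree (p ^ k) \<le> n"
  shows "(\<Sum>m\<le>n. coeff (p ^ k) m * x ^ m * (real m - real k)\<^sup>2) =
    real k * (x\<^sup>2 * poly (pderiv (pderiv p)) x / poly p x) * poly p x ^ k"
proof -
  let ?P = "poly p x"
  have d1: "x * poly (pderiv (p ^ k)) x = real k * ?P ^ k"
  proof -
    have "x * poly (pderiv (p ^ k)) x * ?P = ?P ^ k * (real k * (x * poly (pderiv p) x))"
      using pderiv_power_poly[of p k x] by (simp add: mult_ac)
    then show ?thesis unfolding crit using pos by (simp add: mult_ac)
  qed
  have d2: "x\<^sup>2 * poly (pderiv (pderiv (p ^ k))) x =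
      ?P ^ k * (real k * (x\<^sup>2 * poly (pderiv (pderiv p)) x / ?P) + real k * (real k - 1))"
  proof -
    have "x\<^sup>2 * poly (pderiv (pderiv (p ^ k))) x * ?P\<^sup>2 =
        ?P ^ k * (real k * ?P * (x\<^sup>2 * poly (pderiv (pderiv p)) x) + real k * (real k - 1) * (x * poly (pderiv p) x)\<^sup>2)"
      unfolding mult.assoc[of "x\<^sup>2"] pderiv2_power_poly by (simp add: algebra_simps power_mult_distrib)
    also have "\<dots> = ?P ^ k * (real k * (x\<^sup>2 * poly (pderiv (pderiv p)) x / ?P) + real k * (real k - 1)) * ?P\<^sup>2"
      unfolding crit using pos by (simp add: field_simps power2_eq_square)
    finally show ?thesis using pos by simp
  qed
  have "(\<Sum>m\<le>n. coeff (p ^ k) m * x ^ m * (real m - real k)\<^sup>2) =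
      x\<^sup>2 * poly (pderiv (pderiv (p ^ k))) x + (1 - 2 * real k) * (x * poly (pderiv (p ^ k)) x) + (real k)\<^sup>2 * ?P ^ k"
    using poly_second_moment[OF assms(3), of x "real k"] by (simp add: mult_ac)
  also have "\<dots> = real k * (x\<^sup>2 * poly (pderiv (pderiv p)) x / ?P) * ?P ^ k"
    unfolding d1 d2 by (simp add: algebra_simps power2_eq_square)
  finally show ?thesis .
qed

text \<open>With nonnegative coefficients a single term is at most the whole sum; this is the
  saddle-point upper bound.\<close>

lemma coeff_power_le:
  fixes p :: "real poly"
  assumes "\<And>i. 0 \<le> coeff p i" "0 \<le> x"
  shows "coeff (p ^ k) m * x ^ m \<le> poly p x ^ k"
proof (cases "m \<le> degree (p ^ k)")
  case True
  then have "coeff (p ^ k) m * x ^ m \<le> (\<Sum>i\<le>degree (p ^ k). coeff (p ^ k) i * x ^ i)"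
    using coeff_power_nonneg[of p k] assms
    by (intro member_le_sum[of m _ "\<lambda>i. coeff (p ^ k) i * x ^ i"]) auto
  then show ?thesis by (simp add: poly_altdef[symmetric])
next
  case False
  have "0 \<le> poly p x" unfolding poly_altdef using assms by (intro sum_nonneg mult_nonneg_nonneg) auto
  then show ?thesis using False by (simp add: coeff_eq_0)
qed

text \<open>Since \<Delta> \<ge> 3, each factor can contribute an exponent 0, 1 or 2 with a
  coefficient of at least 1/2, so \<open>r\<close> factors reach every exponent up to 2r.\<close>

lemma coeff_trunc_exp_power_ge:
  assumes "3 \<le> \<Delta>"
  shows "s \<le> 2 * r \<Longrightarrow> (1 / 2) ^ r \<le> coeff (trunc_exp_poly \<Delta> ^ r) s"
proof (induction r arbitrary: s)
  case 0
  then show ?case by simp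
next
  case (Suc r)
  \<comment> \<open>The new factor contributes only the excess over what the other \<open>r\<close>
    factors reach.\<close>
  define j where "j = (if s \<le> 2 * r then 0 else s - 2 * r)"
  have j: "j \<le> 2" "j \<le> s" "s - j \<le> 2 * r" using Suc.prems by (auto simp: j_def)
  then have "j = 0 \<or> j = 1 \<or> j = 2" by linarith
  then have "1 / 2 \<le> coeff (trunc_exp_poly \<Delta>) j"
    using assms by (auto simp: coeff_trunc_exp_poly)
  then have "(1 / 2) ^ Suc r \<le> coeff (trunc_exp_poly \<Delta>) j * coeff (trunc_exp_poly \<Delta> ^ r) (s - j)"
    using Suc.IH[OF j(3)] by (simp only: power_Suc) (intro mult_mono, auto simp: coeff_trunc_exp_poly_power_nonneg)
  also have "\<dots> \<le> (\<Sum>i\<le>s. coeff (trunc_exp_poly \<Delta>) i * coeff (trunc_exp_poly \<Delta> ^ r) (s - i))"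
    using j coeff_trunc_exp_poly_power_nonneg[of \<Delta> 1] coeff_trunc_exp_poly_power_nonneg[of \<Delta> r]
    by (intro member_le_sum[of j _ "\<lambda>i. coeff (trunc_exp_poly \<Delta>) i * coeff (trunc_exp_poly \<Delta> ^ r) (s - i)"]) auto
  finally show ?case by (simp add: coeff_mult)
qed

text \<open>At the critical point the coefficients of the \<open>k\<close>-th power are, after normalisation, a distribution of
  mean \<open>k\<close> and variance linear in \<open>k\<close>. Chebyshev puts half of the mass of the \<open>(k - r)\<close>-th power at distance
  less than \<open>r\<close> from its mean, and the remaining \<open>r\<close> factors correct the exponent.\<close>
lemma coeff_trunc_exp_power_lower:
  fixes \<Delta> k r :: nat
  defines "p \<equiv> trunc_exp_poly \<Delta>" and "x \<equiv> alpha_crit \<Delta>"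
  assumes \<Delta>: "3 \<le> \<Delta>" and r: "2 \<le> r" "r \<le> k" and v: "2 * trunc_exp_var \<Delta> x * real k \<le> (real r - 1)\<^sup>2"
  shows "poly p x ^ k \<le> 2 * (2 * poly p x) ^ r * (coeff (p ^ k) (k - 2) * x ^ (k - 2))"
proof -
  define G where "G = poly p x"
  have x1: "1 < x" using alpha_crit[OF \<Delta>] by (simp add: x_def)
  have nonneg: "0 \<le> coeff (p ^ i) m" for i m unfolding p_def by (rule coeff_trunc_exp_poly_power_nonneg)
  have G: "G = gamma_trunc \<Delta> x" using \<Delta> by (simp add: G_def p_def poly_trunc_exp_poly)
  have G1: "0 < G" unfolding G gamma_trunc_def using x1 by (intro sum_pos) auto
  have "pderiv p = trunc_exp_poly (\<Delta> - 1)" using \<Delta> pderiv_trunc_exp_poly[of "\<Delta> - 1"] by (simp add: p_def)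
  then have crit: "x * poly (pderiv p) x = G"
    using alpha_crit(2)[OF \<Delta>] \<Delta> by (simp add: G poly_trunc_exp_poly flip: x_def)
  define k' where "k' = k - r"
  define n where "n = degree (p ^ k') + k"
  define S where "S m = coeff (p ^ k') m * x ^ m" for m
  have S_nonneg: "0 \<le> S m" for m unfolding S_def using nonneg x1 by simp
  have total: "(\<Sum>m\<le>n. S m) = G ^ k'"
  proof -
    have "(\<Sum>m\<le>n. S m) = (\<Sum>m\<le>degree (p ^ k'). S m)"
      unfolding S_def n_def by (intro sum.mono_neutral_right) (auto simp: coeff_eq_0)
    then show ?thesis by (simp add: S_def G_def poly_altdef[symmetric])
  qed
  \<comment> \<open>For \<open>m\<close> in \<open>near\<close> the missing exponent k - 2 - m lies
    between 0 and 2r, the range that the \<open>r\<close> remaining factors can supply.\<close>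
  define near where "near = {m. m + 2 \<le> k \<and> k \<le> m + 2 + 2 * r}"
  have far: "(\<Sum>m\<in>{..n} - near. S m) \<le> G ^ k' / 2"
  proof -
    have "(real r - 1)\<^sup>2 * (\<Sum>m\<in>{..n} - near. S m) \<le> (\<Sum>m\<in>{..n} - near. S m * (real m - real k')\<^sup>2)"
      unfolding sum_distrib_left
    proof (rule sum_mono)
      fix m assume "m \<in> {..n} - near"
      then have "m + 2 > k \<or> k > m + 2 + 2 * r" by (auto simp: near_def)
      \<comment> \<open>As k' = k - r, the nearest excluded exponent m = k - 1 is at distance
        exactly r - 1, which is where the r - 1 of the hypothesis comes from.\<close>
      then have "real r - 1 \<le> \<bar>real m - real k'\<bar>" using r by (auto simp: k'_def)
      then have "(real r - 1)\<^sup>2 \<le> (real m - real k')\<^sup>2" using r by (subst abs_le_square_iff[symmetric]) simp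
      then show "(real r - 1)\<^sup>2 * S m \<le> S m * (real m - real k')\<^sup>2"
        using S_nonneg[of m] by (subst mult.commute) (intro mult_left_mono)
    qed
    also have "\<dots> \<le> (\<Sum>m\<le>n. S m * (real m - real k')\<^sup>2)"
      using S_nonneg by (intro sum_mono2) auto
    also have "\<dots> = real k' * trunc_exp_var \<Delta> x * G ^ k'"
      unfolding S_def using critical_second_moment[of x p k' n] crit G1
      by (simp add: trunc_exp_var_def p_def[symmetric] n_def flip: G_def)
    also have "\<dots> \<le> (real r - 1)\<^sup>2 / 2 * G ^ k'"
    proof (rule mult_right_mono)
      have "0 \<le> trunc_exp_var \<Delta> x"
        unfolding trunc_exp_var_def p_def[symmetric] G_def[symmetric]
      proof -
        have "0 \<le> coeff p i" for i using nonneg[of 1] by simp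
        then have "0 \<le> poly (pderiv (pderiv p)) x"
          unfolding poly_altdef[of "pderiv (pderiv p)"] using x1
          by (intro sum_nonneg mult_nonneg_nonneg) (auto simp: coeff_pderiv)
        then show "0 \<le> x\<^sup>2 * poly (pderiv (pderiv p)) x / G" using G1 by simp
      qed
      then have "real k' * trunc_exp_var \<Delta> x \<le> real k * trunc_exp_var \<Delta> x"
        by (intro mult_right_mono) (auto simp: k'_def)
      then show "real k' * trunc_exp_var \<Delta> x \<le> (real r - 1)\<^sup>2 / 2" using v by (simp add: mult_ac)
    qed (use G1 in simp)
    finally have "(real r - 1)\<^sup>2 * (\<Sum>m\<in>{..n} - near. S m) \<le> (real r - 1)\<^sup>2 * (G ^ k' / 2)" by simp
    moreover have "0 < (real r - 1)\<^sup>2" using r by simp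
    ultimately show ?thesis by (simp only: mult_le_cancel_left_pos)
  qed
  have near_sub: "near \<subseteq> {..n}" "near \<subseteq> {..k - 2}" by (auto simp: near_def n_def)
  have "(\<Sum>m\<in>near. S m) = (\<Sum>m\<le>n. S m) - (\<Sum>m\<in>{..n} - near. S m)"
    using near_sub by (subst sum_diff) auto
  then have "G ^ k' / 2 \<le> (\<Sum>m\<in>near. S m)" using far total by linarith
  then have "(1 / 2) ^ r * (G ^ k' / 2) \<le> (\<Sum>m\<in>near. (1 / 2) ^ r * S m)"
    unfolding sum_distrib_left[symmetric] by (intro mult_left_mono) auto
  also have "\<dots> \<le> (\<Sum>m\<in>near. coeff (p ^ k') m * coeff (p ^ r) (k - 2 - m) * x ^ (k - 2))"
  proof (rule sum_mono)
    fix m assume m: "m \<in> near"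
    then have "(1 / 2) ^ r \<le> coeff (p ^ r) (k - 2 - m)"
      unfolding p_def by (intro coeff_trunc_exp_power_ge[OF \<Delta>]) (auto simp: near_def)
    \<comment> \<open>\<alpha> > 1 enters here: it allows replacing x^m by the larger x^(k -
      2).\<close>
    moreover have "x ^ m \<le> x ^ (k - 2)" using m x1 by (intro power_increasing) (auto simp: near_def)
    ultimately have "(1 / 2) ^ r * (coeff (p ^ k') m * x ^ m) \<le>
        coeff (p ^ r) (k - 2 - m) * (coeff (p ^ k') m * x ^ (k - 2))"
      using nonneg x1 by (intro mult_mono mult_nonneg_nonneg) auto
    then show "(1 / 2) ^ r * S m \<le> coeff (p ^ k') m * coeff (p ^ r) (k - 2 - m) * x ^ (k - 2)"
      by (simp add: S_def mult_ac)
  qed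
  also have "\<dots> \<le> (\<Sum>m\<le>k - 2. coeff (p ^ k') m * coeff (p ^ r) (k - 2 - m) * x ^ (k - 2))"
    using near_sub nonneg x1 by (intro sum_mono2 mult_nonneg_nonneg) auto
  also have "\<dots> = coeff (p ^ k' * p ^ r) (k - 2) * x ^ (k - 2)"
    by (simp add: coeff_mult sum_distrib_right)
  also have "p ^ k' * p ^ r = p ^ k" using r by (simp add: k'_def flip: power_add)
  \<comment> \<open>In the factor 2 (2G)^r, the 2 undoes the loss of half the mass, 2^r the small
    coefficients of the remaining factors, and G^r lifts G^k' to G^k.\<close>
  finally have "(1 / 2) ^ r * (G ^ k' / 2) * (2 * (2 * G) ^ r) \<le> coeff (p ^ k) (k - 2) * x ^ (k - 2) * (2 * (2 * G) ^ r)"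
    using G1 by (intro mult_right_mono) auto
  moreover have "(1 / 2) ^ r * (G ^ k' / 2) * (2 * (2 * G) ^ r) = G ^ (k' + r)"
    by (simp add: power_mult_distrib power_add power_divide)
  moreover have "k' + r = k" using r by (simp add: k'_def)
  ultimately show ?thesis by (simp add: mult_ac flip: G_def)
qed

section \<open>Upper and lower bounds for the number of trees\<close>

definition tree_count :: "nat \<Rightarrow> nat \<Rightarrow> real" where
  "tree_count \<Delta> k = real (card (bounded_trees \<Delta> {..<k}))"

lemma tree_count_1: "card V = 1 \<Longrightarrow> bounded_trees \<Delta> V = {{}}"
  by (auto simp: bounded_trees_def card_1_singleton_iff vertex_pairs_singleton tree_graph_singleton
      max_degree_le_def graph_degree_def)

lemma tree_count_eq:
  assumes "2 \<le> k"
  shows "tree_count \<Delta> k = fact (k - 2) * coeff (trunc_exp_poly \<Delta> ^ k) (k - 2)"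
  using card_bounded_trees[of "{..<k}" \<Delta>] assms by (simp add: tree_count_def)

lemma card_bounded_trees_eq_tree_count:
  assumes "finite V" "V \<noteq> {}"
  shows "real (card (bounded_trees \<Delta> V)) = tree_count \<Delta> (card V)"
proof (cases "2 \<le> card V")
  case True
  then show ?thesis using assms by (simp add: card_bounded_trees tree_count_eq)
next
  case False
  moreover have "0 < card V" using assms by (simp add: card_gt_0_iff)
  ultimately have "card V = 1" by linarith
  then show ?thesis by (simp add: tree_count_def tree_count_1)
qed

text \<open>The coefficient has index k - 2 in a k-th power, so G = \<alpha> a leaves the factor
  \<alpha>^2; and k \<le> 2 (k - 1) bounds (k - 2)! by 2 k! / k^2.\<close>

lemma tree_count_upper:
  assumes \<Delta>: "3 \<le> \<Delta>" and k: "1 \<le> k"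
  shows "tree_count \<Delta> k \<le> 2 * (alpha_crit \<Delta>)\<^sup>2 * fact k * a_crit \<Delta> ^ k / (real k)\<^sup>2"
proof (cases "k = 1")
  case True
  have "1 \<le> (alpha_crit \<Delta>)\<^sup>2 * a_crit \<Delta>"
    using alpha_crit(1)[OF \<Delta>] a_crit_gt_1[OF \<Delta>] 
    using mult_mono[of 1 "(alpha_crit \<Delta>)\<^sup>2" 1 "a_crit \<Delta>"] by (simp add: one_le_power)
  moreover have "tree_count \<Delta> 1 = 1" by (simp add: tree_count_def tree_count_1)
  ultimately show ?thesis using True by simp
next
  case False
  define x where "x = alpha_crit \<Delta>"
  have x: "1 < x" "x * a_crit \<Delta> = gamma_trunc \<Delta> x" using alpha_crit[OF \<Delta>] by (simp_all add: x_def a_crit_def)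
  obtain m where m: "k = m + 2" using False k by (metis Suc_1 add.commute le_Suc_ex le_antisym not_less_eq_eq One_nat_def)
  have "coeff (trunc_exp_poly \<Delta> ^ k) m * x ^ m \<le> (x * a_crit \<Delta>) ^ k"
    using coeff_power_le[of "trunc_exp_poly \<Delta>" x k m] x \<Delta>
    by (simp add: coeff_trunc_exp_poly poly_trunc_exp_poly)
  also have "(x * a_crit \<Delta>) ^ k = x\<^sup>2 * a_crit \<Delta> ^ k * x ^ m"
    by (simp add: m power_mult_distrib power_add mult_ac power2_eq_square)
  finally have "coeff (trunc_exp_poly \<Delta> ^ k) m \<le> x\<^sup>2 * a_crit \<Delta> ^ k"
    using x by (simp only: mult_le_cancel_right_pos zero_less_power)
  then have "tree_count \<Delta> k \<le> fact m * (x\<^sup>2 * a_crit \<Delta> ^ k)"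
    using False k by (simp add: tree_count_eq m)
  also have "fact m * (x\<^sup>2 * a_crit \<Delta> ^ k) \<le> (2 * fact k / (real k)\<^sup>2) * (x\<^sup>2 * a_crit \<Delta> ^ k)"
  proof (rule mult_right_mono)
    have "fact m * (real k)\<^sup>2 \<le> fact m * (2 * (real k * (real k - 1)))"
      by (intro mult_left_mono) (auto simp: m power2_eq_square algebra_simps)
    also have "\<dots> = 2 * fact k" by (simp add: m algebra_simps)
    finally show "fact m \<le> 2 * fact k / (real k)\<^sup>2" using k by (simp add: field_simps)
  qed (use x a_crit_gt_1[OF \<Delta>] in simp)
  finally show ?thesis by (simp add: x_def mult_ac)
qed

text \<open>With \<sigma> the square root of \<rho>, one power \<sigma>^k pays for the factor (2G)^r
  of the coefficient bound and the other for the polynomial loss 2 k^2.\<close>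

lemma tree_count_lower:
  assumes \<Delta>: "3 \<le> \<Delta>" and \<rho>: "1 < \<rho>"
  shows "eventually (\<lambda>k. fact k * a_crit \<Delta> ^ k \<le> \<rho> ^ k * tree_count \<Delta> k) sequentially"
proof -
  define x where "x = alpha_crit \<Delta>"
  define G where "G = gamma_trunc \<Delta> x"
  define \<sigma> where "\<sigma> = sqrt \<rho>"
  have \<sigma>: "1 < \<sigma>" "\<rho> = \<sigma> * \<sigma>" using \<rho> by (simp_all add: \<sigma>_def)
  have x: "1 < x" "x * a_crit \<Delta> = G" using alpha_crit[OF \<Delta>] by (simp_all add: x_def a_crit_def G_def)
  have G: "0 < G" using x a_crit_gt_1[OF \<Delta>] by (metis mult_pos_pos zero_less_one order_less_trans)
  \<comment> \<open>\<open>M\<close> is chosen so that r = k div M costs at most (2G)^r \<le>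
    \<sigma>^k, while r still grows linearly in k, so that (r - 1)^2 outgrows the variance.\<close>
  obtain N where N: "2 * G < \<sigma> ^ N" using real_arch_pow[OF \<sigma>(1)] by blast
  define M where "M = Suc N"
  have "\<sigma> ^ N \<le> \<sigma> ^ M" using \<sigma> by (intro power_increasing) (auto simp: M_def)
  then have M: "2 * G \<le> \<sigma> ^ M" "0 < M" using N by (auto simp: M_def)
  define v where "v = trunc_exp_var \<Delta> x"
  have "eventually (\<lambda>k. 2 * v * real k \<le> (real k / real M - 2)\<^sup>2) sequentially"
    using M by real_asymp
  moreover have "eventually (\<lambda>k. 2 * (real k)\<^sup>2 \<le> \<sigma> ^ k) sequentially" using \<sigma> by real_asymp
  moreover have "eventually (\<lambda>k. 2 * M + 2 \<le> k) sequentially" by (rule eventually_ge_at_top)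
  ultimately show ?thesis
  proof eventually_elim
    case (elim k)
    define r where "r = k div M"
    have r: "2 \<le> r" "r \<le> k" unfolding r_def using elim(3) M(2)
      by (auto simp: less_eq_div_iff_mult_less_eq)
    have "real k / real M - 2 \<le> real r - 1" 
    proof -
      have "k < M * Suc r" unfolding r_def using dividend_less_times_div[OF M(2), of k] by simp
      then have "real k < real M * real (Suc r)" by (metis of_nat_less_iff of_nat_mult)
      then have "real k / real M < real (Suc r)" using M(2) by (simp add: field_simps)
      then show ?thesis by simp
    qed
    moreover have "0 \<le> real k / real M - 2" using elim(3) M(2) by (simp add: field_simps)
    ultimately have "(real k / real M - 2)\<^sup>2 \<le> (real r - 1)\<^sup>2" by (intro power_mono)
    then have "2 * v * real k \<le> (real r - 1)\<^sup>2" using elim(1) by linarith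
    then have "G ^ k \<le> 2 * (2 * G) ^ r * (coeff (trunc_exp_poly \<Delta> ^ k) (k - 2) * x ^ (k - 2))"
      using coeff_trunc_exp_power_lower[OF \<Delta> r] \<Delta> by (simp add: v_def x_def G_def poly_trunc_exp_poly)
    also have "\<dots> \<le> 2 * \<sigma> ^ k * (coeff (trunc_exp_poly \<Delta> ^ k) (k - 2) * x ^ (k - 2))"
    proof (intro mult_right_mono mult_left_mono)
      have "(2 * G) ^ r \<le> (\<sigma> ^ M) ^ r" using M G by (intro power_mono) auto
      also have "\<dots> \<le> \<sigma> ^ k" unfolding power_mult[symmetric] using \<sigma> by (intro power_increasing) (auto simp: r_def)
      finally show "(2 * G) ^ r \<le> \<sigma> ^ k" .
    qed (use coeff_trunc_exp_poly_power_nonneg x in auto)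
    finally have le: "G ^ k \<le> 2 * \<sigma> ^ k * (coeff (trunc_exp_poly \<Delta> ^ k) (k - 2) * x ^ (k - 2))" .
    have "k - 2 + 2 = k" using elim(3) by simp
    then have "x ^ (k - 2) * x\<^sup>2 = x ^ k" by (metis power_add)
    then have "x ^ (k - 2) * (x\<^sup>2 * a_crit \<Delta> ^ k) = G ^ k"
      by (simp add: power_mult_distrib flip: x(2) mult.assoc)
    then have "x ^ (k - 2) * (x\<^sup>2 * a_crit \<Delta> ^ k) \<le> x ^ (k - 2) * (2 * \<sigma> ^ k * coeff (trunc_exp_poly \<Delta> ^ k) (k - 2))"
      using le by (simp add: mult_ac)
    then have c: "x\<^sup>2 * a_crit \<Delta> ^ k \<le> 2 * \<sigma> ^ k * coeff (trunc_exp_poly \<Delta> ^ k) (k - 2)"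
      using x by (simp only: mult_le_cancel_left_pos zero_less_power)
    obtain m where m: "k = m + 2" using elim(3) by (metis add.commute le_Suc_ex add_leD2)
    have "fact k * a_crit \<Delta> ^ k \<le> (fact m * (real k)\<^sup>2) * (x\<^sup>2 * a_crit \<Delta> ^ k)"
    proof (rule mult_mono)
      have "(fact k :: real) = fact m * (real k * (real k - 1))" by (simp add: m algebra_simps)
      also have "\<dots> \<le> fact m * (real k)\<^sup>2" by (intro mult_left_mono) (auto simp: m power2_eq_square)
      finally show "fact k \<le> fact m * (real k)\<^sup>2" .
      show "a_crit \<Delta> ^ k \<le> x\<^sup>2 * a_crit \<Delta> ^ k" using x a_crit_gt_1[OF \<Delta>] by (simp add: one_le_power)
    qed (use a_crit_gt_1[OF \<Delta>] in auto)
    also have "\<dots> \<le> (fact m * (real k)\<^sup>2) * (2 * \<sigma> ^ k * coeff (trunc_exp_poly \<Delta> ^ k) (k - 2))"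
      using c by (intro mult_left_mono) auto
    also have "\<dots> = (2 * (real k)\<^sup>2) * (\<sigma> ^ k * tree_count \<Delta> k)"
      using m by (simp add: tree_count_eq)
    also have "\<dots> \<le> \<sigma> ^ k * (\<sigma> ^ k * tree_count \<Delta> k)"
      using elim(2) \<sigma> by (intro mult_right_mono) (auto simp: tree_count_def)
    finally show ?case by (simp add: \<sigma>(2) power_mult_distrib mult_ac)
  qed
qed

section \<open>Counting forests\<close>

definition bounded_forests :: "nat \<Rightarrow> 'a set \<Rightarrow> 'a set set set" where
  "bounded_forests \<Delta> V = {E. E \<subseteq> vertex_pairs V \<and> forest_graph E \<and> max_degree_le V E \<Delta>}"

lemma finite_bounded_forests [simp]: "finite V \<Longrightarrow> finite (bounded_forests \<Delta> V)"
  by (rule finite_subset[of _ "Pow (vertex_pairs V)"]) (auto simp: bounded_forests_def)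

lemma bounded_trees_subset_forests: "bounded_trees \<Delta> V \<subseteq> bounded_forests \<Delta> V"
  by (auto simp: bounded_trees_def bounded_forests_def tree_graph_def)

text \<open>For w = p / (1 - p), the power w^|E| is, up to the common factor of 1 - p raised to the
  number of pairs, the probability that \<open>V\<close> induces exactly \<open>E\<close>.\<close>

definition forest_weight :: "nat \<Rightarrow> real \<Rightarrow> 'a set \<Rightarrow> real" where
  "forest_weight \<Delta> w V = (\<Sum>E\<in>bounded_forests \<Delta> V. w ^ card E)"

definition component :: "'a set set \<Rightarrow> 'a \<Rightarrow> 'a set" where
  "component E v = {u. (v, u) \<in> {(x, y). {x, y} \<in> E}\<^sup>*}"

lemma component_self: "v \<in> component E v"
  by (simp add: component_def)

lemma component_step: "x \<in> component E v \<Longrightarrow> {x, y} \<in> E \<Longrightarrow> y \<in> component E v"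
  unfolding component_def mem_Collect_eq by (erule rtrancl_into_rtrancl) simp

lemma component_subset:
  assumes "E \<subseteq> vertex_pairs V" "v \<in> V"
  shows "component E v \<subseteq> V"
proof
  fix u assume "u \<in> component E v"
  then have "(v, u) \<in> {(x, y). {x, y} \<in> E}\<^sup>*" by (simp add: component_def)
  then show "u \<in> V"
  proof (cases rule: rtranclE)
    case base
    then show ?thesis using assms by simp
  next
    case (step y)
    then have "{y, u} \<in> E" by simp
    then have "{y, u} \<in> vertex_pairs V" using assms(1) by blast
    then show ?thesis by (simp only: pair_in_vertex_pairs_iff)
  qed
qed

lemma component_edges:
  fixes v :: 'a
  assumes "E \<subseteq> vertex_pairs V"
  defines "C \<equiv> component E v"
  shows "E = E \<inter> vertex_pairs C \<union> E \<inter> vertex_pairs (V - C)"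
proof -
  have "e \<in> vertex_pairs C \<or> e \<in> vertex_pairs (V - C)" if e: "e \<in> E" for e
  proof -
    obtain x y where xy: "e = {x, y}" "x \<in> V" "y \<in> V" "x \<noteq> y"
      using e assms by (blast elim: vertex_pairsE)
    have "x \<in> C \<longleftrightarrow> y \<in> C"
      using component_step[of x E v y] component_step[of y E v x] e xy unfolding C_def
      by (metis insert_commute)
    then show ?thesis using xy by auto
  qed
  then show ?thesis by blast
qed

lemma component_connected: "connected_graph (component E v) (E \<inter> vertex_pairs (component E v))"
  if E: "E \<subseteq> vertex_pairs V"
proof -
  define C where "C = component E v"
  let ?R = "{(x, y). {x, y} \<in> E \<inter> vertex_pairs C}"
  have "(v, u) \<in> ?R\<^sup>*" if "u \<in> C" for u
  proof -
    have "(v, u) \<in> {(x, y). {x, y} \<in> E}\<^sup>*" using that by (simp add: C_def component_def)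
    then show ?thesis
    proof (induction rule: rtrancl_induct)
      case base
      then show ?case by simp
    next
      case (step y z)
      have "y \<in> C" using step(1) by (simp add: C_def component_def)
      moreover have "{y, z} \<in> E" using step(2) by simp
      moreover have "z \<in> C" using calculation component_step[of y E v z] by (simp add: C_def)
      moreover have "y \<noteq> z" using \<open>{y, z} \<in> E\<close> E pair_in_vertex_pairs_iff[of y z V] by blast
      ultimately have "(y, z) \<in> ?R" by simp
      then show ?case using step(3) by (rule rtrancl_into_rtrancl[rotated])
    qed
  qed
  moreover have "sym (?R\<^sup>*)" by (rule sym_rtrancl) (auto simp: sym_def insert_commute)
  ultimately have "(u, u') \<in> ?R\<^sup>*" if "u \<in> C" "u' \<in> C" for u u'
    using that by (meson rtrancl_trans symE)
  moreover have "C \<noteq> {}" using component_self[of v E] unfolding C_def by blast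
  ultimately show ?thesis unfolding connected_graph_def C_def by blast
qed

text \<open>A forest is recovered from the component \<open>C\<close> of \<open>v\<close>, its edges
  inside \<open>C\<close> and those outside; such an injection suffices for an upper bound. The
  weight is multiplicative, and the tree on \<open>C\<close> has \<open>card C - 1\<close>
  edges.\<close>

lemma forest_weight_le_component:
  assumes fin: "finite V" and v: "v \<in> V" and w: "0 \<le> w"
  shows "forest_weight \<Delta> w V \<le>
    (\<Sum>C | C \<subseteq> V \<and> v \<in> C. tree_count \<Delta> (card C) * w ^ (card C - 1) * forest_weight \<Delta> w (V - C))"
proof -
  define decomp where "decomp E = (component E v,
      (E \<inter> vertex_pairs (component E v), E \<inter> vertex_pairs (V - component E v)))" for E
  define T where "T = Sigma {C. C \<subseteq> V \<and> v \<in> C} (\<lambda>C. bounded_trees \<Delta> C \<times> bounded_forests \<Delta> (V - C))"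
  define h where "h = (\<lambda>(C :: 'a set, (E1, E2)). w ^ card (E1 :: 'a set set) * w ^ card (E2 :: 'a set set))"
  have finC: "finite {C. C \<subseteq> V \<and> v \<in> C}" using fin by (auto intro: finite_subset[of _ "Pow V"])
  have finsub: "finite C" if "C \<subseteq> V" for C using that fin finite_subset by blast
  have finT: "finite T" unfolding T_def using finC finsub fin by (intro finite_SigmaI finite_cartesian_product) auto
  have decomp_mem: "decomp E \<in> T" and decomp_weight: "h (decomp E) = w ^ card E"
    if "E \<in> bounded_forests \<Delta> V" for E
  proof -
    define C where "C = component E v"
    have E: "E \<subseteq> vertex_pairs V" "forest_graph E" "max_degree_le V E \<Delta>"
      using that by (auto simp: bounded_forests_def)
    have finE: "finite E" using E fin finite_subset finite_vertex_pairs by blast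
    have C: "C \<subseteq> V" "v \<in> C" using component_subset[OF E(1) v] component_self by (auto simp: C_def)
    have "E \<inter> vertex_pairs C \<in> bounded_trees \<Delta> C"
      using component_connected[OF E(1), of v] forest_graph_mono[OF E(2)]
        max_degree_le_mono[OF E(3) finE _ C(1)] by (auto simp: bounded_trees_def tree_graph_def C_def)
    moreover have "E \<inter> vertex_pairs (V - C) \<in> bounded_forests \<Delta> (V - C)"
      using forest_graph_mono[OF E(2)] max_degree_le_mono[OF E(3) finE]
      by (auto simp: bounded_forests_def)
    ultimately show "decomp E \<in> T" using C by (auto simp: decomp_def T_def C_def)
    have *: "card E = card (E \<inter> vertex_pairs C \<union> E \<inter> vertex_pairs (V - C))"
      using component_edges[OF E(1), of v] by (simp add: C_def)
    have "vertex_pairs C \<inter> vertex_pairs (V - C) = {}"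
      unfolding vertex_pairs_Int[symmetric] by (auto simp: vertex_pairs_def)
    then have "card (E \<inter> vertex_pairs C \<union> E \<inter> vertex_pairs (V - C)) = card (E \<inter> vertex_pairs C) + card (E \<inter> vertex_pairs (V - C))"
      using finE by (intro card_Un_disjoint) blast+
    with * show "h (decomp E) = w ^ card E" by (simp add: h_def decomp_def C_def power_add)
  qed
  have inj: "inj_on decomp (bounded_forests \<Delta> V)"
  proof (rule inj_onI)
    fix E E' assume E: "E \<in> bounded_forests \<Delta> V" "E' \<in> bounded_forests \<Delta> V" "decomp E = decomp E'"
    then have sub: "E \<subseteq> vertex_pairs V" "E' \<subseteq> vertex_pairs V" by (auto simp: bounded_forests_def)
    have "component E v = component E' v"
      "E \<inter> vertex_pairs (component E v) = E' \<inter> vertex_pairs (component E' v)"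
      "E \<inter> vertex_pairs (V - component E v) = E' \<inter> vertex_pairs (V - component E' v)"
      using E(3) unfolding decomp_def prod.inject by blast+
    then show "E = E'" using component_edges[OF sub(1), of v] component_edges[OF sub(2), of v] by metis
  qed
  have "forest_weight \<Delta> w V = (\<Sum>E\<in>bounded_forests \<Delta> V. h (decomp E))"
    by (simp add: forest_weight_def decomp_weight)
  also have "\<dots> = sum h (decomp ` bounded_forests \<Delta> V)"
    using sum.reindex[OF inj, of h] by simp
  also have "\<dots> \<le> sum h T"
    using decomp_mem finT w by (intro sum_mono2) (auto simp: h_def)
  also have "\<dots> = (\<Sum>C | C \<subseteq> V \<and> v \<in> C. \<Sum>y\<in>bounded_trees \<Delta> C \<times> bounded_forests \<Delta> (V - C). h (C, y))"
    unfolding T_def using finC finsub fin by (subst sum.Sigma) auto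
  also have "\<dots> = (\<Sum>C | C \<subseteq> V \<and> v \<in> C. tree_count \<Delta> (card C) * w ^ (card C - 1) * forest_weight \<Delta> w (V - C))"
  proof (rule sum.cong[OF refl])
    fix C assume "C \<in> {C. C \<subseteq> V \<and> v \<in> C}"
    then have C: "C \<subseteq> V" "v \<in> C" "finite C" using finsub by auto
    have "(\<Sum>y\<in>bounded_trees \<Delta> C \<times> bounded_forests \<Delta> (V - C). h (C, y)) =
        (\<Sum>E1\<in>bounded_trees \<Delta> C. \<Sum>E2\<in>bounded_forests \<Delta> (V - C). w ^ card E1 * w ^ card E2)"
      by (simp add: h_def sum.cartesian_product)
    also have "\<dots> = (\<Sum>E1\<in>bounded_trees \<Delta> C. w ^ (card C - 1) * forest_weight \<Delta> w (V - C))"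
    proof (rule sum.cong[OF refl])
      fix E1 assume "E1 \<in> bounded_trees \<Delta> C"
      then have "card E1 = card C - 1"
        using card_tree_edges[OF C(3), of E1] by (simp add: bounded_trees_def)
      then show "(\<Sum>E2\<in>bounded_forests \<Delta> (V - C). w ^ card E1 * w ^ card E2) =
          w ^ (card C - 1) * forest_weight \<Delta> w (V - C)"
        by (simp add: forest_weight_def sum_distrib_left)
    qed
    also have "\<dots> = tree_count \<Delta> (card C) * w ^ (card C - 1) * forest_weight \<Delta> w (V - C)"
      using C card_bounded_trees_eq_tree_count[of C \<Delta>] by auto
    finally show "(\<Sum>y\<in>bounded_trees \<Delta> C \<times> bounded_forests \<Delta> (V - C). h (C, y)) =
      tree_count \<Delta> (card C) * w ^ (card C - 1) * forest_weight \<Delta> w (V - C)" .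
  qed
  finally show ?thesis .
qed

lemma sum_Pow_card:
  fixes f :: "nat \<Rightarrow> 'b :: comm_semiring_1"
  assumes "finite A"
  shows "(\<Sum>B\<in>Pow A. f (card B)) = (\<Sum>j\<le>card A. of_nat (card A choose j) * f j)"
proof -
  have "(\<Sum>B\<in>Pow A. f (card B)) = (\<Sum>j\<le>card A. \<Sum>B | B \<in> Pow A \<and> card B = j. f (card B))"
    using assms by (subst sum.group) (auto simp: card_mono)
  also have "\<dots> = (\<Sum>j\<le>card A. of_nat (card A choose j) * f j)"
    using n_subsets[OF assms] by (simp add: Pow_def)
  finally show ?thesis .
qed

text \<open>The coefficients of \<open>exp (c * (\<Sum>j\<ge>1. x ^ j / j\<^sup>2))\<close>.\<close>
fun forest_seq :: "real \<Rightarrow> nat \<Rightarrow> real" where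
  "forest_seq c 0 = 1"
| "forest_seq c (Suc n) = c / real (Suc n) * (\<Sum>j\<le>n. forest_seq c (n - j) / real (Suc j))"

lemma forest_seq_nonneg: "0 \<le> c \<Longrightarrow> 0 \<le> forest_seq c n"
  by (induction c n rule: forest_seq.induct)
    (auto simp del: of_nat_Suc intro!: mult_nonneg_nonneg sum_nonneg divide_nonneg_nonneg)

text \<open>After division by n! (a w)^n the component recursion becomes that of
  \<open>forest_seq\<close>, which is the identity f' = (log f)' f for its generating function.
  Since binomial(n, j) (j + 1)! (n - j)! = (j + 1) n!, one of the two factors 1 / (j + 1) in the
  tree bound is used up. The constant has 1 / w because a tree has one edge fewer than
  vertices.\<close>

lemma forest_weight_le:
  assumes \<Delta>: "3 \<le> \<Delta>" and w: "0 < w" and fin: "finite V"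
  shows "forest_weight \<Delta> w V \<le>
    fact (card V) * (a_crit \<Delta> * w) ^ card V * forest_seq (2 * (alpha_crit \<Delta>)\<^sup>2 / w) (card V)"
  using fin
proof (induction "card V" arbitrary: V rule: less_induct)
  case less
  show ?case
  proof (cases "V = {}")
    case True
    have "bounded_forests \<Delta> ({} :: 'a set) = {{}}"
      by (auto simp: bounded_forests_def vertex_pairs_def forest_graph_def graph_cycle_def max_degree_le_def
          intro!: exI[of _ 0])
    then show ?thesis using True by (simp add: forest_weight_def)
  next
    case False
    then obtain v where v: "v \<in> V" by blast
    define c where "c = 2 * (alpha_crit \<Delta>)\<^sup>2 / w"
    define y where "y = a_crit \<Delta> * w"
    have y: "0 < y" using a_crit_gt_1[OF \<Delta>] w by (simp add: y_def)
    have c: "0 \<le> c" using w by (simp add: c_def)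
    obtain n where n: "card V = Suc n" using False less.prems by (metis card_gt_0_iff gr0_implies_Suc)
    define g where "g j = c * y ^ Suc n * (fact (Suc j) * fact (n - j) * forest_seq c (n - j) / (real (Suc j))\<^sup>2)" for j
    have "forest_weight \<Delta> w V \<le>
      (\<Sum>C | C \<subseteq> V \<and> v \<in> C. tree_count \<Delta> (card C) * w ^ (card C - 1) * forest_weight \<Delta> w (V - C))"
      by (rule forest_weight_le_component[OF less.prems v]) (use w in simp)
    also have "\<dots> \<le> (\<Sum>C | C \<subseteq> V \<and> v \<in> C. g (card C - 1))"
    proof (rule sum_mono)
      fix C assume "C \<in> {C. C \<subseteq> V \<and> v \<in> C}"
      then have C: "C \<subseteq> V" "v \<in> C" "finite C" using finite_subset[OF _ less.prems] by auto
      obtain j where j: "card C = Suc j" using C by (metis card_gt_0_iff empty_iff gr0_implies_Suc)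
      have "j \<le> n" using card_mono[OF less.prems C(1)] n j by simp
      have cardVC: "card (V - C) = n - j" using C j n by (simp add: card_Diff_subset)
      have "tree_count \<Delta> (Suc j) * w ^ j \<le> (2 * (alpha_crit \<Delta>)\<^sup>2 * fact (Suc j) * a_crit \<Delta> ^ Suc j / (real (Suc j))\<^sup>2) * w ^ j"
        using tree_count_upper[OF \<Delta>, of "Suc j"] w by (intro mult_right_mono) auto
      also have "\<dots> = c * y ^ Suc j * fact (Suc j) / (real (Suc j))\<^sup>2"
        using w by (simp add: c_def y_def power_mult_distrib field_simps del: fact_Suc of_nat_Suc)
      finally have 1: "tree_count \<Delta> (Suc j) * w ^ j \<le> c * y ^ Suc j * fact (Suc j) / (real (Suc j))\<^sup>2" .
      have 2: "forest_weight \<Delta> w (V - C) \<le> fact (n - j) * y ^ (n - j) * forest_seq c (n - j)"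
        using less.hyps[of "V - C"] less.prems cardVC n by (simp add: c_def y_def)
      have "tree_count \<Delta> (Suc j) * w ^ j * forest_weight \<Delta> w (V - C) \<le>
         (c * y ^ Suc j * fact (Suc j) / (real (Suc j))\<^sup>2) * (fact (n - j) * y ^ (n - j) * forest_seq c (n - j))"
        using 1 2 y c w by (intro mult_mono) (auto simp: forest_weight_def intro!: sum_nonneg)
      also have "\<dots> = g j"
      proof -
        have "Suc j + (n - j) = Suc n" using \<open>j \<le> n\<close> by simp
        then have "y ^ Suc n = y ^ Suc j * y ^ (n - j)" by (metis power_add)
        then show ?thesis by (simp only: g_def) (simp add: mult_ac del: fact_Suc of_nat_Suc power_Suc)
      qed
      finally show "tree_count \<Delta> (card C) * w ^ (card C - 1) * forest_weight \<Delta> w (V - C) \<le> g (card C - 1)"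
        by (simp add: j)
    qed
    also have "\<dots> = (\<Sum>B\<in>Pow (V - {v}). g (card B))"
      by (rule sum.reindex_bij_witness[of _ "insert v" "\<lambda>C. C - {v}"])
        (use v less.prems finite_subset in \<open>auto simp: card_Diff_singleton insert_absorb\<close>)
    also have "\<dots> = (\<Sum>j\<le>n. real (n choose j) * g j)"
      using sum_Pow_card[of "V - {v}" g] less.prems v n by simp
    also have "\<dots> = (\<Sum>j\<le>n. c * y ^ Suc n * fact n * (forest_seq c (n - j) / real (Suc j)))"
    proof (rule sum.cong[OF refl])
      fix j assume "j \<in> {..n}"
      then have "(fact n :: real) = real (n choose j) * fact j * fact (n - j)"
        by (simp add: binomial_fact)
      then show "real (n choose j) * g j = c * y ^ Suc n * fact n * (forest_seq c (n - j) / real (Suc j))"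
        unfolding g_def by (simp add: power2_eq_square fact_Suc del: of_nat_Suc)
    qed
    also have "\<dots> = y ^ Suc n * fact (Suc n) * forest_seq c (Suc n)"
      by (simp add: sum_distrib_left mult_ac)
    finally show ?thesis using n by (simp add: c_def y_def mult_ac)
  qed
qed

text \<open>A bound of order 1 / n reproduces itself: the convolution of 1 / j with itself is of
  order (log n) / n, and the prefactor c / n makes up for the logarithm once n is large.\<close>

lemma forest_seq_tendsto_0:
  assumes c: "0 < c"
  shows "forest_seq c \<longlonglongrightarrow> 0"
proof -
  have "eventually (\<lambda>n. 2 * c * (ln (real (Suc n)) + 1) \<le> real (Suc n)) sequentially" using c by real_asymp
  then obtain N where N: "\<And>n. N \<le> n \<Longrightarrow> 2 * c * (ln (real (Suc n)) + 1) \<le> real (Suc n)"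
    by (auto simp: eventually_sequentially)
  \<comment> \<open>The sum dominates each of its terms, so the bound holds up to \<open>N\<close>,
    where the induction takes over.\<close>
  define K where "K = (\<Sum>i\<le>N. forest_seq c i * real (Suc i))"
  have K: "0 \<le> K" unfolding K_def using forest_seq_nonneg c by (intro sum_nonneg mult_nonneg_nonneg) auto
  have bound: "forest_seq c n \<le> K / real (Suc n)" for n
  proof (induction n rule: less_induct)
    case (less n)
    show ?case
    proof (cases "n \<le> N")
      case True
      then have "forest_seq c n * real (Suc n) \<le> K"
        unfolding K_def using forest_seq_nonneg[of c] c
        by (intro member_le_sum[of n _ "\<lambda>i. forest_seq c i * real (Suc i)"]) auto
      then show ?thesis by (simp add: field_simps)
    next
      case False
      then obtain m where m: "n = Suc m" "N \<le> m" by (metis Suc_le_eq not_less_eq_eq gr0_implies_Suc not_le zero_less_iff_neq_zero le0 le_less_trans less_Suc_eq_le)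
      have harm: "(\<Sum>j\<le>m. 1 / real (Suc j)) = harm (Suc m)"
        unfolding harm_altdef lessThan_Suc_atMost[symmetric] by (simp add: inverse_eq_divide)
      \<comment> \<open>Partial fractions, used with A = j + 1 and B = m - j + 1, whose sum m + 2
        does not depend on j; the convolution becomes two harmonic sums.\<close>
      have split_fraction: "K / B / A = K / (A + B) * (1 / A + 1 / B)" if "0 < A" "0 < B" for A B :: real
      proof -
        have "1 / A + 1 / B = (A + B) / (A * B)" using that by (simp add: field_simps)
        moreover have "K / (A + B) * ((A + B) / (A * B)) = K / B / A" using that by (simp add: mult.commute)
        ultimately show ?thesis by (simp only:)
      qed
      have "(\<Sum>j\<le>m. forest_seq c (m - j) / real (Suc j)) \<le> (\<Sum>j\<le>m. K / real (Suc (m - j)) / real (Suc j))"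
        using m by (intro sum_mono divide_right_mono less.IH) auto
      also have "\<dots> = (\<Sum>j\<le>m. K / real (m + 2) * (1 / real (Suc j) + 1 / real (Suc (m - j))))"
      proof (rule sum.cong[OF refl])
        fix j assume "j \<in> {..m}"
        then have m2: "real (m + 2) = real (Suc j) + real (Suc (m - j))" by simp
        show "K / real (Suc (m - j)) / real (Suc j) = K / real (m + 2) * (1 / real (Suc j) + 1 / real (Suc (m - j)))"
          unfolding m2 by (rule split_fraction) (rule of_nat_0_less_iff[THEN iffD2], rule zero_less_Suc)+
      qed
      also have "\<dots> = K / real (m + 2) * ((\<Sum>j\<le>m. 1 / real (Suc j)) + (\<Sum>j\<le>m. 1 / real (Suc (m - j))))"
        by (simp only: sum_distrib_left sum.distrib distrib_left)
      also have "(\<Sum>j\<le>m. 1 / real (Suc (m - j))) = (\<Sum>j\<le>m. 1 / real (Suc j))"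
        by (rule sum.reindex_bij_witness[of _ "\<lambda>j. m - j" "\<lambda>j. m - j"]) auto
      finally have "(\<Sum>j\<le>m. forest_seq c (m - j) / real (Suc j)) \<le> K / real (m + 2) * (2 * harm (Suc m))"
        unfolding harm by simp
      then have "forest_seq c n \<le> c / real (Suc m) * (K / real (m + 2) * (2 * harm (Suc m)))"
        unfolding m forest_seq.simps using c by (intro mult_left_mono) auto
      also have "\<dots> = K / real (m + 2) * (2 * c * harm (Suc m) / real (Suc m))" by (simp add: mult_ac)
      also have "\<dots> \<le> K / real (m + 2) * 1"
      proof (rule mult_left_mono)
        \<comment> \<open>The difference of \<open>harm (Suc n)\<close> and ln (n + 1) decreases
          from its value 1 at n = 0.\<close>
        have "2 * c * harm (Suc m) \<le> 2 * c * (ln (real (Suc m)) + 1)"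
          using decseqD[OF decseq_harm_diff_ln, of 0 m] c
          by (intro mult_left_mono) (auto simp: harm_def)
        also have "\<dots> \<le> real (Suc m)" by (rule N[OF m(2)])
        finally show "2 * c * harm (Suc m) / real (Suc m) \<le> 1" by simp
      qed (use K in simp)
      finally show ?thesis by (simp add: m(1))
    qed
  qed
  have "(\<lambda>n. K / real (Suc n)) \<longlonglongrightarrow> 0" by real_asymp
  then show ?thesis
    by (rule tendsto_sandwich[OF _ _ tendsto_const, rotated 2])
      (use bound forest_seq_nonneg c in \<open>auto intro!: always_eventually\<close>)
qed

section \<open>Moments in the random graph\<close>

lemma prob_gnp_restrict:
  assumes p: "0 < p" "p < 1" and P: "P \<subseteq> vertex_pairs {1..n}" and A: "A \<subseteq> P"
  shows "measure_pmf.prob (gnp n p) {E. E \<inter> P = A} = (p / (1 - p)) ^ card A * (1 - p) ^ card P"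
proof -
  let ?V = "vertex_pairs {1..n}"
  have fin: "finite ?V" by simp
  have finP: "finite P" by (rule finite_subset[OF P fin])
  have finA: "finite A" by (rule finite_subset[OF A finP])
  note fin = fin finP finA
  \<comment> \<open>\<open>{e \<in> A}\<close> is the singleton of a truth value: it prescribes the
    coordinate \<open>e\<close>, while coordinates outside \<open>P\<close> are free.\<close>
  define B where "B e = (if e \<in> P then {e \<in> A} else UNIV)" for e
  have "(\<lambda>X. {e \<in> ?V. X e}) -` {E. E \<inter> P = A} = Pi ?V B"
    using P A by (auto simp: B_def Pi_def split: if_splits)
  then have "measure_pmf.prob (gnp n p) {E. E \<inter> P = A} = (\<Prod>e\<in>?V. measure_pmf.prob (bernoulli_pmf p) (B e))"
    unfolding gnp_def measure_map_pmf by (simp add: measure_Pi_pmf_Pi fin)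
  also have "\<dots> = (\<Prod>e\<in>P. if e \<in> A then p else 1 - p)"
    using P fin p by (intro prod.mono_neutral_cong_right) (auto simp: B_def measure_pmf_single)
  also have "\<dots> = p ^ card A * (1 - p) ^ (card P - card A)"
    using A fin by (subst prod.If_cases) (auto simp: Int_absorb1 card_Diff_subset Diff_eq[symmetric])
  also have "\<dots> = (p / (1 - p)) ^ card A * (1 - p) ^ card P"
  proof -
    have "card A \<le> card P" using A fin by (simp add: card_mono)
    then have "(1 - p) ^ card P = (1 - p) ^ card A * (1 - p) ^ (card P - card A)"
      by (simp flip: power_add)
    then show ?thesis using p by (simp add: power_divide)
  qed
  finally show ?thesis .
qed

lemma set_gnp: "set_pmf (gnp n p) \<subseteq> Pow (vertex_pairs {1..n})"
  by (auto simp: gnp_def)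

text \<open>Union bound over vertex sets and forests; the k! of the forest count is absorbed by k!
  binomial(n, k) \<le> n^k.\<close>

lemma prob_induced_forest_le:
  assumes p: "0 < p" "p < 1" and \<Delta>: "3 \<le> \<Delta>"
  defines "w \<equiv> p / (1 - p)"
  shows "measure_pmf.prob (gnp n p)
      {E. \<exists>S\<subseteq>{1..n}. card S = k \<and> E \<inter> vertex_pairs S \<in> bounded_forests \<Delta> S}
    \<le> (a_crit \<Delta> * w * real n) ^ k * (1 - p) ^ (k choose 2) * forest_seq (2 * (alpha_crit \<Delta>)\<^sup>2 / w) k"
proof -
  define SS where "SS = {S. S \<subseteq> {1..n} \<and> card S = k}"
  have finSS: "finite SS" and cardSS: "card SS = n choose k"
    using n_subsets[of "{1..n}" k] by (auto simp: SS_def intro: finite_subset[of _ "Pow {1..n}"])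
  have w: "0 < w" using p by (simp add: w_def)
  define e where "e = forest_seq (2 * (alpha_crit \<Delta>)\<^sup>2 / w) k"
  have e: "0 \<le> e" unfolding e_def using w by (intro forest_seq_nonneg) simp
  have one: "measure_pmf.prob (gnp n p) {E. E \<inter> vertex_pairs S \<in> bounded_forests \<Delta> S} \<le>
      fact k * (a_crit \<Delta> * w) ^ k * e * (1 - p) ^ (k choose 2)" if "S \<in> SS" for S
  proof -
    have S: "S \<subseteq> {1..n}" "card S = k" "finite S" using that finite_subset by (auto simp: SS_def)
    have "{E. E \<inter> vertex_pairs S \<in> bounded_forests \<Delta> S} =
        (\<Union>F\<in>bounded_forests \<Delta> S. {E. E \<inter> vertex_pairs S = F})" by auto
    then have "measure_pmf.prob (gnp n p) {E. E \<inter> vertex_pairs S \<in> bounded_forests \<Delta> S} \<le>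
        (\<Sum>F\<in>bounded_forests \<Delta> S. measure_pmf.prob (gnp n p) {E. E \<inter> vertex_pairs S = F})"
      using S by (simp add: measure_pmf.finite_measure_subadditive_finite)
    also have "\<dots> = (\<Sum>F\<in>bounded_forests \<Delta> S. w ^ card F * (1 - p) ^ (k choose 2))"
    proof (rule sum.cong[OF refl])
      fix F assume "F \<in> bounded_forests \<Delta> S"
      then have "F \<subseteq> vertex_pairs S" by (simp add: bounded_forests_def)
      then show "measure_pmf.prob (gnp n p) {E. E \<inter> vertex_pairs S = F} = w ^ card F * (1 - p) ^ (k choose 2)"
        using prob_gnp_restrict[OF p vertex_pairs_mono[OF S(1)], of F] S by (simp add: card_vertex_pairs w_def)
    qed
    also have "\<dots> = forest_weight \<Delta> w S * (1 - p) ^ (k choose 2)"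
      by (simp add: forest_weight_def sum_distrib_right)
    also have "\<dots> \<le> fact k * (a_crit \<Delta> * w) ^ k * e * (1 - p) ^ (k choose 2)"
      using forest_weight_le[OF \<Delta> w S(3)] p S(2) by (intro mult_right_mono) (auto simp: e_def)
    finally show ?thesis .
  qed
  have "{E. \<exists>S\<subseteq>{1..n}. card S = k \<and> E \<inter> vertex_pairs S \<in> bounded_forests \<Delta> S} =
      (\<Union>S\<in>SS. {E. E \<inter> vertex_pairs S \<in> bounded_forests \<Delta> S})" by (auto simp: SS_def)
  then have "measure_pmf.prob (gnp n p)
      {E. \<exists>S\<subseteq>{1..n}. card S = k \<and> E \<inter> vertex_pairs S \<in> bounded_forests \<Delta> S} \<le>
      (\<Sum>S\<in>SS. measure_pmf.prob (gnp n p) {E. E \<inter> vertex_pairs S \<in> bounded_forests \<Delta> S})"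
    using finSS by (simp add: measure_pmf.finite_measure_subadditive_finite)
  also have "\<dots> \<le> (\<Sum>S\<in>SS. fact k * (a_crit \<Delta> * w) ^ k * e * (1 - p) ^ (k choose 2))"
    by (intro sum_mono one)
  also have "\<dots> = real ((n choose k) * fact k) * ((a_crit \<Delta> * w) ^ k * e * (1 - p) ^ (k choose 2))"
    by (simp add: cardSS)
  also have "\<dots> \<le> real (n ^ k) * ((a_crit \<Delta> * w) ^ k * e * (1 - p) ^ (k choose 2))"
    using binomial_fact_pow[of n k] a_crit_gt_1[OF \<Delta>] w e p
    by (intro mult_right_mono) (simp_all only: of_nat_le_iff, simp)
  finally show ?thesis by (simp add: power_mult_distrib e_def mult_ac)
qed

text \<open>Chebyshev for the number \<open>X\<close> of events that occur: where X = 0, the square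
  (X - m)^2 equals m^2. Keeping the inequality multiplied by m^2 avoids a division.\<close>

lemma second_moment_method:
  fixes M :: "'a pmf" and A :: "'i \<Rightarrow> 'a set"
  assumes fin: "finite I"
  defines "m \<equiv> \<Sum>i\<in>I. measure_pmf.prob M (A i)"
  shows "measure_pmf.prob M {x. \<forall>i\<in>I. x \<notin> A i} * m\<^sup>2 \<le>
    (\<Sum>i\<in>I. \<Sum>j\<in>I. measure_pmf.prob M (A i \<inter> A j)) - m\<^sup>2"
proof -
  let ?N = "{x. \<forall>i\<in>I. x \<notin> A i}"
  define X :: "'a \<Rightarrow> real" where "X x = (\<Sum>i\<in>I. indicator (A i) x)" for x
  have sq: "(X x - m)\<^sup>2 = (\<Sum>i\<in>I. \<Sum>j\<in>I. indicator (A i \<inter> A j) x) - 2 * m * (\<Sum>i\<in>I. indicator (A i) x) + m\<^sup>2" for x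
    unfolding X_def by (simp add: power2_eq_square indicator_inter_arith sum_product algebra_simps)
  have int: "integrable M (\<lambda>x. indicator B x :: real)" for B by (simp add: integrable_indicator_iff measure_pmf.emeasure_eq_measure)
  have "measure_pmf.prob M ?N * m\<^sup>2 = measure_pmf.expectation M (\<lambda>x. m\<^sup>2 * indicator ?N x)" by simp
  also have "\<dots> \<le> measure_pmf.expectation M (\<lambda>x. (X x - m)\<^sup>2)"
  proof (rule integral_mono)
    show "integrable M (\<lambda>x. (X x - m)\<^sup>2)" unfolding sq
      by (intro Bochner_Integration.integrable_add Bochner_Integration.integrable_diff
          Bochner_Integration.integrable_sum integrable_mult_right int) simp
    show "m\<^sup>2 * indicator ?N x \<le> (X x - m)\<^sup>2" for x
    proof (cases "x \<in> ?N")
      case True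
      then have "X x = 0" by (simp add: X_def)
      then show ?thesis using True by simp
    qed simp
  qed (simp add: int)
  also have "\<dots> = (\<Sum>i\<in>I. \<Sum>j\<in>I. measure_pmf.prob M (A i \<inter> A j)) - 2 * m * m + m\<^sup>2"
    unfolding sq
    by (subst Bochner_Integration.integral_add Bochner_Integration.integral_diff,
        (intro Bochner_Integration.integrable_add Bochner_Integration.integrable_diff
          Bochner_Integration.integrable_sum integrable_mult_right int, simp)+,
        subst Bochner_Integration.integral_diff)
       (auto intro!: Bochner_Integration.integrable_sum integrable_mult_right int
         simp: Bochner_Integration.integral_sum int m_def)
  finally show ?thesis by (simp add: power2_eq_square)
qed

section \<open>Pairs of overlapping trees\<close>

lemma card_subsets_le:
  assumes "finite X"
  shows "card {A. A \<subseteq> X \<and> card A \<le> m} \<le> (card X + 1) ^ m"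
proof -
  have "{A. A \<subseteq> X \<and> card A \<le> m} = (\<Union>i\<le>m. {A. A \<subseteq> X \<and> card A = i})" by auto
  then have "card {A. A \<subseteq> X \<and> card A \<le> m} \<le> (\<Sum>i\<le>m. card {A. A \<subseteq> X \<and> card A = i})"
    by (simp add: card_UN_le)
  also have "\<dots> = (\<Sum>i\<le>m. card X choose i)" using n_subsets[OF assms] by simp
  also have "\<dots> \<le> (\<Sum>i\<le>m. (m choose i) * card X ^ i)"
  proof (rule sum_mono)
    fix i assume "i \<in> {..m}"
    then have "1 \<le> m choose i" by (simp add: Suc_le_eq)
    moreover have "card X choose i \<le> card X ^ i"
      by (cases "i \<le> card X") (auto simp: binomial_le_pow binomial_eq_0)
    ultimately show "card X choose i \<le> (m choose i) * card X ^ i"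
      using mult_mono[of 1 "m choose i" "card X choose i" "card X ^ i"] by simp
  qed
  also have "\<dots> = (card X + 1) ^ m" using binomial[of "card X" 1 m] by (simp only: power_one mult_1_right of_nat_id)
  finally show ?thesis .
qed

lemma card_edges_meeting_le:
  assumes fin: "finite E" and U: "finite U" "U \<subseteq> V" and deg: "max_degree_le V E \<Delta>"
    and F: "F \<subseteq> E" "\<And>e. e \<in> F \<Longrightarrow> e \<inter> U \<noteq> {}"
  shows "card F \<le> \<Delta> * card U"
proof -
  have "F \<subseteq> (\<Union>v\<in>U. {e \<in> E. v \<in> e})" using F by blast
  then have "card F \<le> card (\<Union>v\<in>U. {e \<in> E. v \<in> e})" using fin U by (intro card_mono) auto
  also have "\<dots> \<le> (\<Sum>v\<in>U. card {e \<in> E. v \<in> e})" using U by (intro card_UN_le)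
  also have "\<dots> \<le> (\<Sum>v\<in>U. \<Delta>)"
    using deg U by (intro sum_mono) (auto simp: max_degree_le_def graph_degree_def)
  finally show ?thesis by (simp add: mult.commute)
qed

text \<open>A tree on \<open>S'\<close> with prescribed edges inside \<open>S\<close> is determined
  by its other edges. Each of these meets \<open>S' - S\<close>, so the degree bound limits their
  number.\<close>

lemma card_extending_trees_le:
  assumes fin: "finite S'" and F: "\<And>T. T \<in> \<T> \<Longrightarrow> T \<inter> vertex_pairs S = F"
    and \<T>: "\<T> \<subseteq> bounded_trees \<Delta> S'"
  shows "card \<T> \<le> ((card S')\<^sup>2 + 1) ^ (\<Delta> * card (S' - S))"
proof -
  let ?D = "{A. A \<subseteq> vertex_pairs S' \<and> card A \<le> \<Delta> * card (S' - S)}"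
  have "card (T - vertex_pairs S) \<le> \<Delta> * card (S' - S)" if "T \<in> \<T>" for T
  proof (rule card_edges_meeting_le)
    have T: "T \<subseteq> vertex_pairs S'" "max_degree_le S' T \<Delta>" using that \<T> by (auto simp: bounded_trees_def)
    show "finite T" using T fin finite_subset finite_vertex_pairs by blast
    show "max_degree_le S' T \<Delta>" by (rule T)
    fix e assume "e \<in> T - vertex_pairs S"
    then show "e \<inter> (S' - S) \<noteq> {}" using T by (auto simp: vertex_pairs_def)
  qed (use fin in auto)
  then have sub: "(\<lambda>T. T - vertex_pairs S) ` \<T> \<subseteq> ?D"
    using \<T> by (auto simp: bounded_trees_def)
  have inj: "inj_on (\<lambda>T. T - vertex_pairs S) \<T>"
  proof (rule inj_onI)
    fix T T' assume "T \<in> \<T>" "T' \<in> \<T>" and eq: "T - vertex_pairs S = T' - vertex_pairs S"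
    then have "T \<inter> vertex_pairs S = T' \<inter> vertex_pairs S" using F by simp
    with eq show "T = T'" by blast
  qed
  have "card \<T> = card ((\<lambda>T. T - vertex_pairs S) ` \<T>)" by (rule card_image[OF inj, symmetric])
  also have "\<dots> \<le> card ?D"
    by (rule card_mono[OF _ sub]) (use fin in \<open>auto intro: finite_subset[of _ "Pow (vertex_pairs S')"]\<close>)
  also have "\<dots> \<le> (card (vertex_pairs S') + 1) ^ (\<Delta> * card (S' - S))"
    by (rule card_subsets_le) (use fin in simp)
  also have "\<dots> \<le> ((card S')\<^sup>2 + 1) ^ (\<Delta> * card (S' - S))"
  proof (rule power_mono)
    have "card S' choose 2 \<le> (card S')\<^sup>2" by (cases "2 \<le> card S'") (auto simp: binomial_le_pow binomial_eq_0)
    then show "card (vertex_pairs S') + 1 \<le> (card S')\<^sup>2 + 1" using fin by (simp add: card_vertex_pairs)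
  qed simp
  finally show ?thesis .
qed

lemma card_subsets_meeting:
  assumes fin: "finite V" and S: "S \<subseteq> V" "card S = k" and l: "l \<le> k"
  shows "card {S'. S' \<subseteq> V \<and> card S' = k \<and> card (S \<inter> S') = l} \<le> (k choose l) * (card V - k choose (k - l))"
proof -
  let ?X = "{S'. S' \<subseteq> V \<and> card S' = k \<and> card (S \<inter> S') = l}"
  let ?Y = "{I. I \<subseteq> S \<and> card I = l} \<times> {D. D \<subseteq> V - S \<and> card D = k - l}"
  have finS: "finite S" using S fin finite_subset by blast
  have "card (S' - S) = k - l" if "S' \<in> ?X" for S'
  proof -
    have "finite S'" using that fin finite_subset by blast
    then have "card (S' - S) = card S' - card (S' \<inter> S)" by (simp add: card_Diff_subset_Int)
    then show ?thesis using that by (simp add: Int_commute)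
  qed
  then have sub: "(\<lambda>S'. (S \<inter> S', S' - S)) ` ?X \<subseteq> ?Y" by auto
  have inj: "inj_on (\<lambda>S'. (S \<inter> S', S' - S)) ?X" by (rule inj_onI) blast
  have "finite {I. I \<subseteq> S \<and> card I = l}" using finS by simp
  moreover have "finite {D. D \<subseteq> V - S \<and> card D = k - l}" using fin by simp
  ultimately have "card ?X \<le> card ?Y"
    by (intro card_inj_on_le[OF inj sub] finite_cartesian_product)
  also have "\<dots> = (k choose l) * (card V - k choose (k - l))"
    using n_subsets[OF finS, of l] n_subsets[of "V - S" "k - l"] fin S finS
    by (simp add: card_cartesian_product card_Diff_subset)
  finally show ?thesis .
qed

text \<open>The hypotheses \<open>F\<close> say that the trees agree on the common pairs. The
  formula isolates the probability of the first tree, because \<open>T\<close> will be fixed while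
  \<open>T'\<close> varies.\<close>

lemma prob_two_induced_trees:
  assumes p: "0 < p" "p < 1" and S: "S \<subseteq> {1..n}" "card S = k" and S': "S' \<subseteq> {1..n}" "card S' = k"
    and T: "T \<in> bounded_trees \<Delta> S" and T': "T' \<in> bounded_trees \<Delta> S'"
    and F: "T \<inter> vertex_pairs S' = F" "T' \<inter> vertex_pairs S = F"
  defines "w \<equiv> p / (1 - p)"
  shows "measure_pmf.prob (gnp n p) ({E. E \<inter> vertex_pairs S = T} \<inter> {E. E \<inter> vertex_pairs S' = T'}) =
    (w ^ (k - 1) * (1 - p) ^ (k choose 2)) * (w ^ (k - 1 - card F) * (1 - p) ^ ((k choose 2) - (card (S \<inter> S') choose 2)))"
    and "card F \<le> k - 1"
proof -
  have fin: "finite S" "finite S'" using S S' finite_subset by auto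
  have Tsub: "T \<subseteq> vertex_pairs S" "T' \<subseteq> vertex_pairs S'" using T T' by (auto simp: bounded_trees_def)
  have finT: "finite T" "finite T'"
    using finite_subset[OF Tsub(1)] finite_subset[OF Tsub(2)] fin by simp_all
  have cardT: "card T = k - 1" "card T' = k - 1"
    using card_tree_edges[OF fin(1) Tsub(1)] card_tree_edges[OF fin(2) Tsub(2)] T T' S S'
    by (auto simp: bounded_trees_def)
  have TT': "T \<inter> T' = F" using F Tsub by blast
  have "F \<subseteq> T" using TT' by blast
  then show le: "card F \<le> k - 1" using card_mono[OF finT(1)] cardT by simp
  have "card (T \<union> T') + card F = 2 * (k - 1)"
    using card_Un_Int[OF finT] cardT TT' by simp
  then have cardU: "card (T \<union> T') = (k - 1) + (k - 1 - card F)" using le by simp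
  have inter: "vertex_pairs S \<inter> vertex_pairs S' = vertex_pairs (S \<inter> S')" by (rule vertex_pairs_Int[symmetric])
  have "card (vertex_pairs S \<union> vertex_pairs S') + (card (S \<inter> S') choose 2) = 2 * (k choose 2)"
    using card_Un_Int[of "vertex_pairs S" "vertex_pairs S'"] fin S S' inter by (simp add: card_vertex_pairs)
  moreover have "card (S \<inter> S') choose 2 \<le> k choose 2"
    using S fin by (intro binomial_right_mono) (auto intro: card_mono)
  ultimately have cardP: "card (vertex_pairs S \<union> vertex_pairs S') = (k choose 2) + ((k choose 2) - (card (S \<inter> S') choose 2))"
    by simp
  have "{E. E \<inter> vertex_pairs S = T} \<inter> {E. E \<inter> vertex_pairs S' = T'} =
      {E. E \<inter> (vertex_pairs S \<union> vertex_pairs S') = T \<union> T'}" (is "?L = ?R")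
  proof (intro equalityI subsetI)
    fix E assume "E \<in> ?L" then show "E \<in> ?R" by blast
  next
    fix E assume "E \<in> ?R"
    then have E: "E \<inter> vertex_pairs S \<union> E \<inter> vertex_pairs S' = T \<union> T'" by (simp add: Int_Un_distrib)
    have "E \<inter> vertex_pairs S = (T \<union> T') \<inter> vertex_pairs S" using E by blast
    moreover have "(T \<union> T') \<inter> vertex_pairs S = T" using Tsub F \<open>F \<subseteq> T\<close> by blast
    moreover have "E \<inter> vertex_pairs S' = (T \<union> T') \<inter> vertex_pairs S'" using E by blast
    moreover have "(T \<union> T') \<inter> vertex_pairs S' = T'" using Tsub F TT' by blast
    ultimately show "E \<in> ?L" by simp
  qed
  then show "measure_pmf.prob (gnp n p) ({E. E \<inter> vertex_pairs S = T} \<inter> {E. E \<inter> vertex_pairs S' = T'}) =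
    (w ^ (k - 1) * (1 - p) ^ (k choose 2)) * (w ^ (k - 1 - card F) * (1 - p) ^ ((k choose 2) - (card (S \<inter> S') choose 2)))"
    using prob_gnp_restrict[OF p, of "vertex_pairs S \<union> vertex_pairs S'" n "T \<union> T'"]
      vertex_pairs_mono[OF S(1)] vertex_pairs_mono[OF S'(1)] Un_mono[OF Tsub]
    by (simp add: cardU cardP power_add w_def mult_ac)
qed

text \<open>Two bounds for the same sum. The first, for small overlap, counts every
  \<open>T'\<close> and uses that there are at most \<Delta> l common edges. The second, for large
  overlap, counts extensions of the common edges, each by at most \<Delta> (k - l) new ones.
  \<open>B\<close> dominates both w and 1 / w because either may exceed 1.\<close>

lemma sum_prob_two_induced_trees:
  assumes p: "0 < p" "p < 1" and S: "S \<subseteq> {1..n}" "card S = k" and S': "S' \<subseteq> {1..n}" "card S' = k"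
    and k: "1 \<le> k" and T: "T \<in> bounded_trees \<Delta> S"
  defines "w \<equiv> p / (1 - p)"
  assumes B: "1 \<le> B" "w \<le> B" "1 / w \<le> B"
  defines "l \<equiv> card (S \<inter> S')" and "pr \<equiv> w ^ (k - 1) * (1 - p) ^ (k choose 2)"
  defines "s \<equiv> \<Sum>T'\<in>bounded_trees \<Delta> S'. measure_pmf.prob (gnp n p)
      ({E. E \<inter> vertex_pairs S = T} \<inter> {E. E \<inter> vertex_pairs S' = T'})"
  shows "s \<le> tree_count \<Delta> k * pr\<^sup>2 * B ^ (\<Delta> * l) / (1 - p) ^ (l choose 2)"
    and "s \<le> real ((k\<^sup>2 + 1) ^ (\<Delta> * (k - l))) * B ^ (\<Delta> * (k - l)) * pr *
      (1 - p) ^ ((k choose 2) - (l choose 2))"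
proof -
  have w: "0 < w" using p by (simp add: w_def)
  have pr: "0 < pr" using p w by (simp add: pr_def)
  have fin: "finite S" "finite S'" using S S' finite_subset by auto
  have Tsub: "T \<subseteq> vertex_pairs S" "max_degree_le S T \<Delta>" using T by (auto simp: bounded_trees_def)
  have finT: "finite T" using finite_subset[OF Tsub(1)] fin by simp
  have lk: "l \<le> k" using S fin by (auto simp: l_def intro: card_mono)
  have l2: "l choose 2 \<le> k choose 2" using lk by (rule binomial_right_mono)
  define F where "F = T \<inter> vertex_pairs S'"
  define \<T> where "\<T> = {T' \<in> bounded_trees \<Delta> S'. T' \<inter> vertex_pairs S = F}"
  have F_small: "card F \<le> \<Delta> * l"
    unfolding l_def
  proof (rule card_edges_meeting_le[OF finT _ _ Tsub(2)])
    fix e assume "e \<in> F"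
    then have "e \<in> vertex_pairs (S \<inter> S')" using Tsub by (auto simp: F_def vertex_pairs_Int)
    then have "e \<subseteq> S \<inter> S'" "e \<noteq> {}" by (auto simp: vertex_pairs_def)
    then show "e \<inter> (S \<inter> S') \<noteq> {}" by blast
  qed (use fin in \<open>auto simp: F_def\<close>)
  have zero: "measure_pmf.prob (gnp n p) ({E. E \<inter> vertex_pairs S = T} \<inter> {E. E \<inter> vertex_pairs S' = T'}) = 0"
    if "T' \<in> bounded_trees \<Delta> S' - \<T>" for T'
  proof -
    have "{E. E \<inter> vertex_pairs S = T} \<inter> {E. E \<inter> vertex_pairs S' = T'} = {}"
      using that by (auto simp: \<T>_def F_def)
    then show ?thesis by simp
  qed
  have pair: "measure_pmf.prob (gnp n p) ({E. E \<inter> vertex_pairs S = T} \<inter> {E. E \<inter> vertex_pairs S' = T'}) =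
      pr * (w ^ (k - 1 - card F) * (1 - p) ^ ((k choose 2) - (l choose 2)))"
    and F_le: "card F \<le> k - 1" and F_big: "k - 1 - card F \<le> \<Delta> * (k - l)" if "T' \<in> \<T>" for T'
  proof -
    have T': "T' \<in> bounded_trees \<Delta> S'" "T' \<inter> vertex_pairs S = F" using that by (auto simp: \<T>_def)
    show "measure_pmf.prob (gnp n p) ({E. E \<inter> vertex_pairs S = T} \<inter> {E. E \<inter> vertex_pairs S' = T'}) =
      pr * (w ^ (k - 1 - card F) * (1 - p) ^ ((k choose 2) - (l choose 2)))"
      using prob_two_induced_trees(1)[OF p S S' T T'(1) F_def[symmetric] T'(2)]
      by (simp add: pr_def w_def l_def)
    show "card F \<le> k - 1"
      by (rule prob_two_induced_trees(2)[OF p S S' T T'(1) F_def[symmetric] T'(2)])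
    have cardT: "card T = k - 1" using card_tree_edges[OF fin(1) Tsub(1)] T S by (auto simp: bounded_trees_def)
    have "card (T - vertex_pairs S') \<le> \<Delta> * card (S - S')"
    proof (rule card_edges_meeting_le[OF finT _ _ Tsub(2)])
      fix e assume "e \<in> T - vertex_pairs S'"
      then show "e \<inter> (S - S') \<noteq> {}" using Tsub by (auto simp: vertex_pairs_def)
    qed (use fin in auto)
    moreover have "card (T - vertex_pairs S') = k - 1 - card F"
      using card_Diff_subset_Int[of T "vertex_pairs S'"] finT cardT by (simp add: F_def)
    moreover have "card (S - S') = k - l" using card_Diff_subset_Int[of S S'] fin S by (simp add: l_def)
    ultimately show "k - 1 - card F \<le> \<Delta> * (k - l)" by simp
  qed
  have s: "s = real (card \<T>) * (pr * (w ^ (k - 1 - card F) * (1 - p) ^ ((k choose 2) - (l choose 2))))"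
  proof -
    have "s = (\<Sum>T'\<in>\<T>. measure_pmf.prob (gnp n p)
      ({E. E \<inter> vertex_pairs S = T} \<inter> {E. E \<inter> vertex_pairs S' = T'}))"
      unfolding s_def by (rule sum.mono_neutral_right) (use fin zero in \<open>auto simp: \<T>_def\<close>)
    then show ?thesis by (simp add: pair)
  qed
  have card1: "real (card \<T>) \<le> tree_count \<Delta> k"
  proof -
    have "card \<T> \<le> card (bounded_trees \<Delta> S')" using fin by (intro card_mono) (auto simp: \<T>_def)
    moreover have "S' \<noteq> {}" using S' k by auto
    ultimately show ?thesis using card_bounded_trees_eq_tree_count[of S' \<Delta>] fin S' by simp
  qed
  have card2: "card \<T> \<le> (k\<^sup>2 + 1) ^ (\<Delta> * (k - l))"
  proof -
    have "card (S' - S) = k - l" using card_Diff_subset_Int[of S' S] fin S' by (simp add: l_def Int_commute)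
    then show ?thesis
      using card_extending_trees_le[OF fin(2), of \<T> S F \<Delta>] S' by (simp add: \<T>_def)
  qed
  show "s \<le> tree_count \<Delta> k * pr\<^sup>2 * B ^ (\<Delta> * l) / (1 - p) ^ (l choose 2)"
  proof (cases "\<T> = {}")
    case True
    then show ?thesis using s pr B p by (simp add: tree_count_def)
  next
    case False
    then have le: "card F \<le> k - 1" using F_le by blast
    have "w ^ (k - 1 - card F) * w ^ card F = w ^ (k - 1)"
      using le by (metis power_add le_add_diff_inverse2)
    then have "w ^ (k - 1 - card F) = w ^ (k - 1) * (1 / w) ^ card F"
      using w by (simp add: power_one_over field_simps)
    moreover have "(1 - p) ^ ((k choose 2) - (l choose 2)) = (1 - p) ^ (k choose 2) / (1 - p) ^ (l choose 2)"
      using l2 p by (simp add: power_diff)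
    ultimately have "s = real (card \<T>) * (pr * (pr * (1 / w) ^ card F / (1 - p) ^ (l choose 2)))"
      unfolding s pr_def by simp
    also have "\<dots> \<le> tree_count \<Delta> k * (pr * (pr * B ^ (\<Delta> * l) / (1 - p) ^ (l choose 2)))"
    proof (intro mult_mono divide_right_mono mult_left_mono card1)
      have "(1 / w) ^ card F \<le> B ^ card F" using B w by (intro power_mono) auto
      also have "\<dots> \<le> B ^ (\<Delta> * l)" using F_small B by (intro power_increasing) auto
      finally show "(1 / w) ^ card F \<le> B ^ (\<Delta> * l)" .
    qed (use pr w p in \<open>auto simp: tree_count_def\<close>)
    finally show ?thesis by (simp add: power2_eq_square mult_ac)
  qed
  show "s \<le> real ((k\<^sup>2 + 1) ^ (\<Delta> * (k - l))) * B ^ (\<Delta> * (k - l)) * pr *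
      (1 - p) ^ ((k choose 2) - (l choose 2))"
  proof (cases "\<T> = {}")
    case True
    then show ?thesis using s pr B p by simp
  next
    case False
    then have big: "k - 1 - card F \<le> \<Delta> * (k - l)" using F_big by blast
    have "w ^ (k - 1 - card F) \<le> B ^ (k - 1 - card F)" using B w by (intro power_mono) auto
    also have "\<dots> \<le> B ^ (\<Delta> * (k - l))" using big B by (intro power_increasing) auto
    finally have "s \<le> real ((k\<^sup>2 + 1) ^ (\<Delta> * (k - l))) * (pr * (B ^ (\<Delta> * (k - l)) * (1 - p) ^ ((k choose 2) - (l choose 2))))"
      unfolding s using card2 pr w p B
      by (intro mult_mono) (auto simp only: of_nat_le_iff intro!: mult_right_mono mult_left_mono mult_nonneg_nonneg zero_le_power)
    then show ?thesis by (simp only: mult_ac)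
  qed
qed

text \<open>From binomial(n, k) binomial(k, l) = binomial(n, l) binomial(n - l, k - l): two factors
  binomial(k, l) \<le> k^l, divided by binomial(n, l) \<ge> (n / k)^l, yield (k^3 / n)^l.\<close>

lemma card_subsets_meeting_few:
  assumes S: "S \<subseteq> {1..n}" "card S = k" and l: "l \<le> k"
  shows "real (card {S'. S' \<subseteq> {1..n} \<and> card S' = k \<and> card (S \<inter> S') = l}) \<le>
    real (n choose k) * (real k ^ 3 / real n) ^ l"
proof (cases "l = 0")
  case True
  have "card {S'. S' \<subseteq> {1..n} \<and> card S' = k \<and> card (S \<inter> S') = l} \<le> card {S'. S' \<subseteq> {1..n} \<and> card S' = k}"
    by (rule card_mono) (auto intro: finite_subset[of _ "Pow {1..n}"])
  also have "\<dots> = n choose k" using n_subsets[of "{1..n}" k] by simp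
  finally show ?thesis using True by simp
next
  case False
  have kn: "k \<le> n" using S card_mono[of "{1..n}" S] by simp
  have k: "0 < k" "0 < n" "l \<le> n" using False l kn by auto
  have ge: "(real n / real k) ^ l \<le> real (n choose l)"
  proof -
    have "(real n / real k) ^ l \<le> (real n / real l) ^ l"
      using False l k by (intro power_mono divide_left_mono) auto
    also have "\<dots> \<le> real (n choose l)" using k by (intro binomial_ge_n_over_k_pow_k) simp
    finally show ?thesis .
  qed
  have "card {S'. S' \<subseteq> {1..n} \<and> card S' = k \<and> card (S \<inter> S') = l} \<le> (k choose l) * (n - k choose (k - l))"
    using card_subsets_meeting[OF _ S l] by simp
  also have "\<dots> \<le> (k choose l) * (n - l choose (k - l))"
    using l by (intro mult_left_mono binomial_right_mono) auto
  finally have "real (card {S'. S' \<subseteq> {1..n} \<and> card S' = k \<and> card (S \<inter> S') = l}) * (real n / real k) ^ l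
      \<le> real ((k choose l) * (n - l choose (k - l))) * real (n choose l)"
    using ge by (intro mult_mono) (auto simp only: of_nat_le_iff of_nat_0_le_iff, auto)
  also have "\<dots> = real (k choose l) * real ((n choose k) * (k choose l))"
    using choose_mult[OF l kn] by simp
  also have "\<dots> \<le> real k ^ l * (real (n choose k) * real k ^ l)"
    using binomial_le_pow[OF l]
    by (simp only: of_nat_mult) (intro mult_mono, auto simp flip: of_nat_power)
  finally have "real (card {S'. S' \<subseteq> {1..n} \<and> card S' = k \<and> card (S \<inter> S') = l}) * (real n / real k) ^ l
     \<le> real (n choose k) * (real k * real k) ^ l" by (simp add: power_mult_distrib mult_ac)
  then have "real (card {S'. S' \<subseteq> {1..n} \<and> card S' = k \<and> card (S \<inter> S') = l}) \<le>
     real (n choose k) * (real k * real k) ^ l / (real n / real k) ^ l"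
    using k by (simp add: field_simps)
  also have "\<dots> = real (n choose k) * (real k ^ 3 / real n) ^ l"
    by (simp add: power_divide power_mult_distrib power3_eq_cube mult_ac)
  finally show ?thesis .
qed

text \<open>Only j vertices of \<open>S\<close> are exchanged, so here the count is exponential in j
  instead of being compared with binomial(n, k).\<close>

lemma card_subsets_meeting_many:
  assumes S: "S \<subseteq> {1..n}" "card S = k" and j: "j \<le> k"
  shows "card {S'. S' \<subseteq> {1..n} \<and> card S' = k \<and> card (S \<inter> S') = k - j} \<le> (k * n) ^ j"
proof -
  have "card {S'. S' \<subseteq> {1..n} \<and> card S' = k \<and> card (S \<inter> S') = k - j} \<le>
      (k choose (k - j)) * (n - k choose (k - (k - j)))"
    using card_subsets_meeting[OF _ S, of "k - j"] by simp
  also have "\<dots> = (k choose j) * (n - k choose j)" using j by (simp add: binomial_symmetric[symmetric])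
  also have "\<dots> \<le> k ^ j * n ^ j"
  proof (rule mult_mono)
    show "k choose j \<le> k ^ j" using j by (rule binomial_le_pow)
    show "n - k choose j \<le> n ^ j"
    proof (cases "j \<le> n - k")
      case True
      then have "n - k choose j \<le> (n - k) ^ j" by (rule binomial_le_pow)
      also have "\<dots> \<le> n ^ j" by (intro power_mono) auto
      finally show ?thesis .
    qed (simp add: binomial_eq_0)
  qed auto
  finally show ?thesis by (simp add: power_mult_distrib)
qed

lemma sum_power_le:
  fixes x :: real
  assumes "0 \<le> x" "x \<le> 1 / 2"
  shows "(\<Sum>i<m. x ^ i) \<le> 2"
proof -
  have "(\<Sum>i<m. x ^ i) = (1 - x ^ m) / (1 - x)" using assms by (subst sum_gp_strict) auto
  also have "\<dots> \<le> 1 / (1 / 2)" using assms by (intro frac_le) auto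
  finally show ?thesis by simp
qed

lemma four_choose_two: "4 * (m choose 2) = 2 * m * (m - 1)"
proof -
  have "even (m * (m - 1))" by (cases m) auto
  then show ?thesis by (simp add: choose_two)
qed

text \<open>Overlaps of size \<open>l \<le> k / 2\<close> contribute a geometric series of ratio \<open>\<theta>\<^sub>1\<close>; overlaps of size
  \<open>k - j > k / 2\<close> contribute one of ratio \<open>\<theta>\<^sub>2\<close>, relative to the expectation \<open>M\<close>.\<close>
theorem prob_no_induced_tree_le:
  fixes h B p :: real and n k \<Delta> :: nat
  assumes h: "0 < h" "h < 1" and p: "1 - p = h ^ 4" and k: "1 \<le> k" "k \<le> n"
  defines "w \<equiv> p / (1 - p)"
  assumes B: "1 \<le> B" "w \<le> B" "1 / w \<le> B"
  defines "M \<equiv> real (n choose k) * tree_count \<Delta> k * (w ^ (k - 1) * (1 - p) ^ (k choose 2))"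
  defines "\<theta>\<^sub>1 \<equiv> real k ^ 3 * B ^ \<Delta> / (real n * h ^ k)"
  defines "\<theta>\<^sub>2 \<equiv> real k * real n * (real k ^ 2 + 1) ^ \<Delta> * B ^ \<Delta> * h ^ (3 * k - 1)"
  assumes M: "0 < M" and \<theta>: "\<theta>\<^sub>1 \<le> 1 / 2" "\<theta>\<^sub>2 \<le> 1 / 2"
  shows "measure_pmf.prob (gnp n p)
      {E. \<forall>S\<subseteq>{1..n}. card S = k \<longrightarrow> E \<inter> vertex_pairs S \<notin> bounded_trees \<Delta> S} \<le> 2 * \<theta>\<^sub>1 + 2 / M"
proof -
  have "h ^ 4 < 1" using h by (simp add: power_less_one_iff)
  then have p01: "0 < p" "p < 1" using h p by (simp_all add: algebra_simps) (metis add.commute diff_add_cancel diff_gt_0_iff_gt zero_less_power p)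
  have w: "0 < w" using p01 by (simp add: w_def)
  define pr where "pr = w ^ (k - 1) * (1 - p) ^ (k choose 2)"
  have pr: "0 < pr" using w p01 by (simp add: pr_def)
  have n: "0 < n" using k by simp
  define SS where "SS = {S. S \<subseteq> {1..n} \<and> card S = k}"
  have finSS: "finite SS" and cardSS: "card SS = n choose k"
    using n_subsets[of "{1..n}" k] by (auto simp: SS_def intro: finite_subset[of _ "Pow {1..n}"])
  have SS: "S \<subseteq> {1..n}" "card S = k" "finite S" "S \<noteq> {}" if "S \<in> SS" for S
    using that finite_subset k by (auto simp: SS_def)
  define I where "I = Sigma SS (bounded_trees \<Delta>)"
  define A where "A = (\<lambda>(S, T). {E. E \<inter> vertex_pairs S = (T :: nat set set)})"
  have finI: "finite I" unfolding I_def using finSS SS by (intro finite_SigmaI) auto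
  have t: "real (card (bounded_trees \<Delta> S)) = tree_count \<Delta> k" if "S \<in> SS" for S
    using card_bounded_trees_eq_tree_count[of S \<Delta>] SS[OF that] by simp
  have cardI: "real (card I) = real (n choose k) * tree_count \<Delta> k"
    unfolding I_def using finSS SS t by (simp add: card_SigmaI cardSS)
  have prA: "measure_pmf.prob (gnp n p) (A i) = pr" if iI: "i \<in> I" for i
  proof -
    obtain S T where i: "i = (S, T)" "S \<in> SS" "T \<in> bounded_trees \<Delta> S" using iI by (auto simp: I_def)
    have T: "T \<subseteq> vertex_pairs S" "card T + 1 = k"
      using i SS[OF i(2)] card_tree_edges[of S T] by (auto simp: bounded_trees_def)
    show ?thesis
      using prob_gnp_restrict[OF p01 vertex_pairs_mono[OF SS(1)[OF i(2)]] T(1)] T(2) SS[OF i(2)]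
      by (simp add: i A_def card_vertex_pairs pr_def w_def flip: T(2))
  qed
  have M_eq: "M = (\<Sum>i\<in>I. measure_pmf.prob (gnp n p) (A i))"
    by (simp add: prA cardI M_def pr_def)
  have t_eq: "M = real (n choose k) * (tree_count \<Delta> k * pr)" by (simp add: M_def pr_def)
  have \<theta>_nonneg: "0 \<le> \<theta>\<^sub>1" "0 \<le> \<theta>\<^sub>2" using B h by (simp_all add: \<theta>\<^sub>1_def \<theta>\<^sub>2_def)
  define cnt where "cnt S l = card {S'. S' \<subseteq> {1..n} \<and> card S' = k \<and> card (S \<inter> S') = l}" for S l
  define b where "b l = (if 2 * l \<le> k then tree_count \<Delta> k * pr\<^sup>2 * B ^ (\<Delta> * l) / (1 - p) ^ (l choose 2)
    else real ((k\<^sup>2 + 1) ^ (\<Delta> * (k - l))) * B ^ (\<Delta> * (k - l)) * pr * (1 - p) ^ ((k choose 2) - (l choose 2)))" for l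
  have small: "real (cnt S l) * b l \<le> pr * M * \<theta>\<^sub>1 ^ l" if S: "S \<in> SS" and l: "2 * l \<le> k" for S l
  proof -
    have "real (cnt S l) * b l \<le> (real (n choose k) * (real k ^ 3 / real n) ^ l) *
        (tree_count \<Delta> k * pr\<^sup>2 * B ^ (\<Delta> * l) / (1 - p) ^ (l choose 2))"
      unfolding cnt_def b_def if_P[OF l] using card_subsets_meeting_few[OF SS(1,2)[OF S], of l] l B p01
      by (intro mult_right_mono) (auto simp: tree_count_def)
    also have "\<dots> = pr * M * ((real k ^ 3 / real n) ^ l * B ^ (\<Delta> * l) * (1 / (1 - p) ^ (l choose 2)))"
      by (simp add: t_eq power2_eq_square mult_ac)
    also have "\<dots> \<le> pr * M * ((real k ^ 3 / real n) ^ l * B ^ (\<Delta> * l) * (1 / (h ^ k) ^ l))"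
    proof (intro mult_left_mono divide_left_mono)
      \<comment> \<open>Since 1 - p = h^4, the exponent of h is 2 l (l - 1), and 2 l \<le> k bounds
        it linearly in l; this makes the small overlaps a geometric series.\<close>
      have "4 * (l choose 2) \<le> k * l"
      proof -
        have "2 * l * (l - 1) \<le> k * l" using l by (metis mult_le_mono mult.commute diff_le_self mult.assoc mult_le_mono2 mult.left_commute le_trans)
        then show ?thesis by (simp add: four_choose_two)
      qed
      then show "(h ^ k) ^ l \<le> (1 - p) ^ (l choose 2)"
        unfolding p power_mult[symmetric] using h by (intro power_decreasing) auto
    qed (use pr M B h p01 in auto)
    also have "\<dots> = pr * M * \<theta>\<^sub>1 ^ l"
      by (simp add: \<theta>\<^sub>1_def power_divide power_mult_distrib power_mult)
    finally show ?thesis .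
  qed
  have large: "real (cnt S (k - j)) * b (k - j) \<le> pr * \<theta>\<^sub>2 ^ j" if S: "S \<in> SS" and j: "2 * j < k" for S j
  proof -
    have "\<not> 2 * (k - j) \<le> k" and jk: "k - (k - j) = j" using j by auto
    then have "real (cnt S (k - j)) * b (k - j) \<le> real ((k * n) ^ j) *
        (real ((k\<^sup>2 + 1) ^ (\<Delta> * j)) * B ^ (\<Delta> * j) * pr * (1 - p) ^ ((k choose 2) - ((k - j) choose 2)))"
      unfolding cnt_def b_def using card_subsets_meeting_many[OF SS(1,2)[OF S], of j] j B p01 pr
      by (simp only: if_False jk) (intro mult_right_mono, simp_all only: of_nat_le_iff, simp_all)
    also have "\<dots> \<le> real ((k * n) ^ j) *
        (real ((k\<^sup>2 + 1) ^ (\<Delta> * j)) * B ^ (\<Delta> * j) * pr * (h ^ (3 * k - 1)) ^ j)"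
    proof (intro mult_left_mono)
      \<comment> \<open>m = k - 2j - 1 is the slack in 4 (binomial(k, 2) - binomial(k - j, 2)) = j
        (3k - 1 + m), so the exponent is at least linear in j.\<close>
      obtain m where m: "k = 2 * j + Suc m" using j by (metis less_iff_Suc_add add_Suc_right)
      have "4 * ((k choose 2) - ((k - j) choose 2)) = 2 * k * (k - 1) - 2 * (k - j) * (k - j - 1)"
        by (simp only: diff_mult_distrib2 four_choose_two)
      also have "\<dots> = j * (3 * k - 1 + m)"
        by (simp add: m algebra_simps)
      finally have "(3 * k - 1) * j \<le> 4 * ((k choose 2) - ((k - j) choose 2))" by simp
      then show "(1 - p) ^ ((k choose 2) - ((k - j) choose 2)) \<le> (h ^ (3 * k - 1)) ^ j"
        unfolding p power_mult[symmetric] using h by (intro power_decreasing) auto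
    qed (use pr B in auto)
    also have "\<dots> = pr * \<theta>\<^sub>2 ^ j"
      by (simp add: \<theta>\<^sub>2_def power_mult_distrib power_mult mult_ac add.commute)
    finally show ?thesis .
  qed
  \<comment> \<open>The 1 is the overlap l = 0, whose contribution cancels against the square of the
    mean; the final 2 bounds all large overlaps, including S' = S at j = 0.\<close>
  have row: "(\<Sum>j\<in>I. measure_pmf.prob (gnp n p) (A i \<inter> A j)) \<le> pr * (M * (1 + 2 * \<theta>\<^sub>1) + 2)" if i: "i \<in> I" for i
  proof -
    obtain S T where ST: "i = (S, T)" "S \<in> SS" "T \<in> bounded_trees \<Delta> S" using i by (auto simp: I_def)
    have "(\<Sum>j\<in>I. measure_pmf.prob (gnp n p) (A i \<inter> A j)) =
       (\<Sum>S'\<in>SS. \<Sum>T'\<in>bounded_trees \<Delta> S'. measure_pmf.prob (gnp n p)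
         ({E. E \<inter> vertex_pairs S = T} \<inter> {E. E \<inter> vertex_pairs S' = T'}))"
      unfolding I_def using finSS SS by (subst sum.Sigma) (auto simp: ST A_def split_def)
    also have "\<dots> \<le> (\<Sum>S'\<in>SS. b (card (S \<inter> S')))"
    proof (rule sum_mono)
      fix S' assume "S' \<in> SS"
      note sum_prob_two_induced_trees[OF p01 SS(1,2)[OF ST(2)] SS(1,2)[OF this] k(1) ST(3) B[unfolded w_def]]
      then show "(\<Sum>T'\<in>bounded_trees \<Delta> S'. measure_pmf.prob (gnp n p)
         ({E. E \<inter> vertex_pairs S = T} \<inter> {E. E \<inter> vertex_pairs S' = T'})) \<le> b (card (S \<inter> S'))"
        unfolding b_def pr_def w_def by simp
    qed
    also have "\<dots> = (\<Sum>l\<le>k. \<Sum>S' | S' \<in> SS \<and> card (S \<inter> S') = l. b (card (S \<inter> S')))"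
    proof (rule sum.group[symmetric])
      show "(\<lambda>S'. card (S \<inter> S')) ` SS \<subseteq> {..k}" using SS[OF ST(2)] by (auto intro: card_mono)
    qed (use finSS in auto)
    also have "\<dots> = (\<Sum>l\<le>k. real (cnt S l) * b l)"
      by (intro sum.cong refl) (simp add: cnt_def SS_def conj_assoc)
    also have "\<dots> = (\<Sum>l | l \<le> k \<and> 2 * l \<le> k. real (cnt S l) * b l) + (\<Sum>l | l \<le> k \<and> \<not> 2 * l \<le> k. real (cnt S l) * b l)"
      by (subst sum.union_disjoint[symmetric]) (auto intro!: sum.cong)
    also have "(\<Sum>l | l \<le> k \<and> \<not> 2 * l \<le> k. real (cnt S l) * b l) = (\<Sum>j | 2 * j < k. real (cnt S (k - j)) * b (k - j))"
      by (rule sum.reindex_bij_witness[of _ "\<lambda>j. k - j" "\<lambda>l. k - l"]) auto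
    also have "(\<Sum>l | l \<le> k \<and> 2 * l \<le> k. real (cnt S l) * b l) + (\<Sum>j | 2 * j < k. real (cnt S (k - j)) * b (k - j)) \<le>
       (\<Sum>l | l \<le> k \<and> 2 * l \<le> k. pr * M * \<theta>\<^sub>1 ^ l) + (\<Sum>j | 2 * j < k. pr * \<theta>\<^sub>2 ^ j)"
      using small[OF ST(2)] large[OF ST(2)] by (intro add_mono sum_mono) auto
    also have "\<dots> \<le> (\<Sum>l<Suc k. pr * M * \<theta>\<^sub>1 ^ l) + (\<Sum>j<k. pr * \<theta>\<^sub>2 ^ j)"
      using pr M \<theta>_nonneg by (intro add_mono sum_mono2) auto
    also have "\<dots> = pr * (M * (1 + \<theta>\<^sub>1 * (\<Sum>l<k. \<theta>\<^sub>1 ^ l)) + (\<Sum>j<k. \<theta>\<^sub>2 ^ j))"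
      by (simp add: sum.lessThan_Suc_shift sum_distrib_left algebra_simps del: sum.lessThan_Suc)
    also have "\<dots> \<le> pr * (M * (1 + \<theta>\<^sub>1 * 2) + 2)"
      using pr M \<theta>_nonneg sum_power_le[OF \<theta>_nonneg(1) \<theta>(1)] sum_power_le[OF \<theta>_nonneg(2) \<theta>(2)]
      by (intro mult_left_mono add_mono) auto
    finally show ?thesis by (simp add: mult.commute)
  qed
  have "{E. \<forall>S\<subseteq>{1..n}. card S = k \<longrightarrow> E \<inter> vertex_pairs S \<notin> bounded_trees \<Delta> S} = {E. \<forall>i\<in>I. E \<notin> A i}"
    by (auto simp: I_def A_def SS_def)
  then have "measure_pmf.prob (gnp n p)
      {E. \<forall>S\<subseteq>{1..n}. card S = k \<longrightarrow> E \<inter> vertex_pairs S \<notin> bounded_trees \<Delta> S} * M\<^sup>2 \<le>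
      (\<Sum>i\<in>I. \<Sum>j\<in>I. measure_pmf.prob (gnp n p) (A i \<inter> A j)) - M\<^sup>2"
    using second_moment_method[OF finI, of "gnp n p" A] by (simp add: M_eq)
  also have "\<dots> \<le> (\<Sum>i\<in>I. pr * (M * (1 + 2 * \<theta>\<^sub>1) + 2)) - M\<^sup>2"
    by (intro diff_right_mono sum_mono row)
  \<comment> \<open>All rows have the same bound, and \<open>card I\<close> times \<open>pr\<close>
    is \<open>M\<close>.\<close>
  also have "\<dots> = M * (M * (1 + 2 * \<theta>\<^sub>1) + 2) - M\<^sup>2"
    by (simp add: cardI t_eq)
  also have "\<dots> = (2 * \<theta>\<^sub>1 + 2 / M) * M\<^sup>2"
    using M by (simp add: power2_eq_square field_simps)
  finally show ?thesis using M by simp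
qed

section \<open>The threshold\<close>

lemma max_induced_tree_eq:
  assumes "E \<subseteq> vertex_pairs V"
  shows "max_induced_tree \<Delta> V E = Max (card ` {S. S \<subseteq> V \<and> E \<inter> vertex_pairs S \<in> bounded_trees \<Delta> S})"
  unfolding max_induced_tree_def
  by (rule arg_cong[where f = Max]) (auto simp: bounded_trees_def induced_edges_eq[OF assms])

lemma max_induced_forest_eq:
  assumes "E \<subseteq> vertex_pairs V"
  shows "max_induced_forest \<Delta> V E = Max (card ` {S. S \<subseteq> V \<and> E \<inter> vertex_pairs S \<in> bounded_forests \<Delta> S})"
  unfolding max_induced_forest_def
  by (rule arg_cong[where f = Max]) (auto simp: bounded_forests_def induced_edges_eq[OF assms])

lemma bounded_forests_restrict:
  assumes "E \<inter> vertex_pairs S \<in> bounded_forests \<Delta> S" "S' \<subseteq> S" "finite S"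
  shows "E \<inter> vertex_pairs S' \<in> bounded_forests \<Delta> S'"
proof -
  have sub: "E \<inter> vertex_pairs S' \<subseteq> E \<inter> vertex_pairs S" using vertex_pairs_mono[OF assms(2)] by blast
  have "finite (E \<inter> vertex_pairs S)" using assms(3) by simp
  then show ?thesis
    using assms forest_graph_mono[OF _ sub] max_degree_le_mono[OF _ _ sub assms(2)]
    by (auto simp: bounded_forests_def)
qed

text \<open>Absence of forests of the single size \<open>m\<close> excludes all larger ones by
  heredity. Every induced tree is an induced forest, so trees inherit the upper bound and forests
  the lower one.\<close>

lemma max_induced_between:
  fixes V :: "'a set"
  assumes fin: "finite V" and E: "E \<subseteq> vertex_pairs V"
    and tree: "S \<subseteq> V" "card S = k" "E \<inter> vertex_pairs S \<in> bounded_trees \<Delta> S"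
    and no_forest: "\<And>S. S \<subseteq> V \<Longrightarrow> card S = m \<Longrightarrow> E \<inter> vertex_pairs S \<notin> bounded_forests \<Delta> S"
  shows "k \<le> max_induced_tree \<Delta> V E" "max_induced_tree \<Delta> V E \<le> max_induced_forest \<Delta> V E"
    "max_induced_forest \<Delta> V E < m"
proof -
  define \<T> where "\<T> = {S. S \<subseteq> V \<and> E \<inter> vertex_pairs S \<in> bounded_trees \<Delta> S}"
  define \<F> where "\<F> = {S. S \<subseteq> V \<and> E \<inter> vertex_pairs S \<in> bounded_forests \<Delta> S}"
  have fin\<F>: "finite \<F>" by (rule finite_subset[of _ "Pow V"]) (use fin in \<open>auto simp: \<F>_def\<close>)
  have sub: "\<T> \<subseteq> \<F>" using bounded_trees_subset_forests by (auto simp: \<T>_def \<F>_def)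
  have S: "S \<in> \<T>" using tree by (simp add: \<T>_def)
  have T: "max_induced_tree \<Delta> V E = Max (card ` \<T>)" unfolding \<T>_def by (rule max_induced_tree_eq[OF E])
  have F: "max_induced_forest \<Delta> V E = Max (card ` \<F>)" unfolding \<F>_def by (rule max_induced_forest_eq[OF E])
  show "k \<le> max_induced_tree \<Delta> V E"
    unfolding T using S tree(2) finite_subset[OF sub fin\<F>] by (metis Max_ge finite_imageI imageI)
  show "max_induced_tree \<Delta> V E \<le> max_induced_forest \<Delta> V E"
    unfolding T F using S sub fin\<F> by (intro Max_mono image_mono) auto
  have "card U < m" if U: "U \<in> \<F>" for U
  proof (rule ccontr)
    assume "\<not> card U < m"
    then obtain S' where S': "S' \<subseteq> U" "card S' = m" by (metis obtain_subset_with_card_n not_less)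
    have "U \<subseteq> V" "E \<inter> vertex_pairs U \<in> bounded_forests \<Delta> U" using U by (auto simp: \<F>_def)
    then have "E \<inter> vertex_pairs S' \<in> bounded_forests \<Delta> S'"
      using bounded_forests_restrict S'(1) fin finite_subset by metis
    then show False using no_forest[of S'] S' \<open>U \<subseteq> V\<close> by blast
  qed
  moreover have "card ` \<F> \<noteq> {}" using S sub by blast
  ultimately show "max_induced_forest \<Delta> V E < m" unfolding F using fin\<F> by (subst Max_less_iff) auto
qed

text \<open>The falling factorial is at least (n - k)^k, and Bernoulli bounds (1 - k / n)^k below by
  1 - k^2 / n \<ge> 1/2.\<close>

lemma power_le_two_fact_binomial:
  assumes "2 * k\<^sup>2 \<le> n"
  shows "real n ^ k \<le> 2 * fact k * real (n choose k)"
proof (cases "k = 0")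
  case False
  have "k \<le> k\<^sup>2" by (simp add: power2_eq_square)
  then have kn: "k \<le> n" "0 < n" using assms False by linarith+
  have "1 / 2 \<le> 1 + real k * (- (real k / real n))"
  proof -
    have "2 * (real k)\<^sup>2 \<le> real n" using assms by (metis of_nat_le_iff of_nat_mult of_nat_numeral of_nat_power)
    then show ?thesis using kn by (simp add: field_simps power2_eq_square)
  qed
  also have "\<dots> \<le> (1 + (- (real k / real n))) ^ k"
    using kn by (intro Bernoulli_inequality) (simp add: field_simps)
  finally have "real n ^ k * (1 / 2) \<le> real n ^ k * (1 - real k / real n) ^ k"
    by (intro mult_left_mono) auto
  also have "\<dots> = (real n - real k) ^ k"
    using kn by (simp add: right_diff_distrib flip: power_mult_distrib)
  also have "\<dots> = (\<Prod>i = 0..<k. real n - real k)" by simp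
  also have "\<dots> \<le> (\<Prod>i = 0..<k. real n - real i)"
    using kn by (intro prod_mono) auto
  also have "\<dots> = fact k * real (n choose k)"
    using gbinomial_mult_fact[of k "real n"] by (simp add: binomial_gbinomial)
  finally show ?thesis by simp
qed simp

text \<open>For x = 2 log_q y all terms are powers of q: y h^(2k) is q^((x - k) / 2) with exponent
  in (-1, -1/2], while h^4 and h^2 have the exponents -1 and -1/2.\<close>

lemma threshold_bounds:
  fixes h q y :: real
  assumes h: "0 < h" "h < 1" and q: "q = 1 / h ^ 4" and y: "0 < y"
    and k: "int k = \<lceil>2 * log q y + 1\<rceil>"
  shows "h ^ 4 < y * h ^ (2 * k)" "y * h ^ (2 * k) \<le> h ^ 2"
proof -
  define x where "x = 2 * log q y"
  have q1: "1 < q" using h unfolding q by (simp add: power_less_one_iff)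
  have hq: "h ^ m = q powr (- real m / 4)" for m
  proof -
    have "h powr 4 = h ^ 4" using h by (simp add: powr_numeral)
    then have "q = h powr (- 4)" using h by (simp add: q powr_minus_divide)
    then show ?thesis using h by (simp add: powr_powr powr_realpow)
  qed
  have "y = q powr (x / 2)" using q1 y by (simp add: x_def)
  then have yh: "y * h ^ (2 * k) = q powr ((x - real k) / 2)"
    unfolding hq by (simp add: powr_add[symmetric] field_simps)
  have "x + 1 \<le> of_int (int k)" "of_int (int k) < x + 2"
    unfolding k x_def by (simp, linarith)
  then have k': "x + 1 \<le> real k" "real k < x + 2" by simp_all
  show "h ^ 4 < y * h ^ (2 * k)" unfolding yh unfolding hq using q1 k' by (intro powr_less_mono) auto
  show "y * h ^ (2 * k) \<le> h ^ 2" unfolding yh unfolding hq using q1 k' by (simp add: powr_mono)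
qed

text \<open>By the threshold the base a n w h^(2 (k - 1)) exceeds 1 / h^2. One factor 1 / h is spent
  on the tree count, taken with \<rho> = 1 / h, and (1 / h)^k remains. The 2 comes from the binomial
  coefficient, the w from a tree having k - 1 edges.\<close>

lemma expected_trees_lower:
  fixes h p :: real
  assumes h: "0 < h" "h < 1" and p: "1 - p = h ^ 4" "0 < p" and k: "1 \<le> k"
  defines "w \<equiv> p / (1 - p)"
  assumes many: "2 * k\<^sup>2 \<le> n"
    and trees: "fact k * a_crit \<Delta> ^ k \<le> (1 / h) ^ k * tree_count \<Delta> k"
    and thr: "h ^ 4 < a_crit \<Delta> * real n * p * h ^ (2 * k)" and a: "0 < a_crit \<Delta>"
  shows "(1 / h) ^ k / (2 * w) \<le> real (n choose k) * tree_count \<Delta> k * (w ^ (k - 1) * (1 - p) ^ (k choose 2))"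
proof -
  have w: "0 < w" unfolding w_def p(1) using p(2) h by simp
  have "real n ^ k * (fact k * a_crit \<Delta> ^ k) \<le>
      (2 * fact k * real (n choose k)) * ((1 / h) ^ k * tree_count \<Delta> k)"
    using a by (intro mult_mono[OF power_le_two_fact_binomial[OF many] trees]) auto
  then have "fact k * (real n ^ k * a_crit \<Delta> ^ k) \<le> fact k * (2 * real (n choose k) * tree_count \<Delta> k * (1 / h) ^ k)"
    by (simp only: mult_ac)
  then have "real n ^ k * a_crit \<Delta> ^ k \<le> 2 * real (n choose k) * tree_count \<Delta> k * (1 / h) ^ k"
    by (simp only: mult_le_cancel_left_pos fact_gt_zero)
  then have "(real n * a_crit \<Delta>) ^ k * h ^ k \<le> 2 * real (n choose k) * tree_count \<Delta> k * (1 / h) ^ k * h ^ k"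
    using h by (intro mult_right_mono) (auto simp: power_mult_distrib)
  then have base: "(real n * a_crit \<Delta> * h) ^ k \<le> 2 * real (n choose k) * tree_count \<Delta> k"
    using h by (simp add: power_mult_distrib power_one_over)
  have "(1 - p) ^ (k choose 2) = h ^ (4 * (k choose 2))" unfolding p power_mult ..
  also have "\<dots> = (h ^ (2 * (k - 1))) ^ k" by (simp add: four_choose_two mult_ac flip: power_mult)
  finally have edges: "(1 - p) ^ (k choose 2) = (h ^ (2 * (k - 1))) ^ k" .
  have wk: "w ^ k = w * w ^ (k - 1)" using k by (metis Suc_diff_1 less_eq_Suc_le One_nat_def power_Suc)
  have "(1 / h) ^ k \<le> (real n * a_crit \<Delta> * h * w * h ^ (2 * (k - 1))) ^ k"
  proof (rule power_mono)
    have "h ^ (2 * k) = h * h * h ^ (2 * (k - 1))"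
    proof -
      have "2 * k = Suc (Suc (2 * (k - 1)))" using k by simp
      then show ?thesis by (simp only: power_Suc mult.assoc)
    qed
    then have "1 < real n * a_crit \<Delta> * w * (h * h * h ^ (2 * (k - 1)))"
      using thr h by (simp add: w_def p(1) field_simps)
    then have "1 / h * h \<le> (real n * a_crit \<Delta> * h * w * h ^ (2 * (k - 1))) * h"
      using h by (simp add: mult_ac)
    then show "1 / h \<le> real n * a_crit \<Delta> * h * w * h ^ (2 * (k - 1))"
      using h by (simp only: mult_le_cancel_right_pos)
  qed (use h in simp)
  also have "\<dots> = (real n * a_crit \<Delta> * h) ^ k * (w * (w ^ (k - 1) * (1 - p) ^ (k choose 2)))"
    unfolding edges by (simp add: power_mult_distrib wk mult_ac)
  also have "\<dots> \<le> (2 * real (n choose k) * tree_count \<Delta> k) * (w * (w ^ (k - 1) * (1 - p) ^ (k choose 2)))"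
    using base w h unfolding edges by (intro mult_right_mono) auto
  finally have "(1 / h) ^ k \<le> real (n choose k) * tree_count \<Delta> k * (w ^ (k - 1) * (1 - p) ^ (k choose 2)) * (2 * w)"
    by (simp only: mult_ac)
  then show ?thesis using w by (subst pos_divide_le_eq) simp_all
qed

text \<open>The two extra vertices bring the base of the union bound down to at most 1; what remains
  is the \<open>forest_seq\<close> factor.\<close>

lemma prob_forest_at_threshold:
  fixes h p :: real
  assumes h: "0 < h" "h < 1" and p: "1 - p = h ^ 4" "0 < p" and \<Delta>: "3 \<le> \<Delta>"
    and thr: "a_crit \<Delta> * real n * p * h ^ (2 * k) \<le> h ^ 2"
  shows "measure_pmf.prob (gnp n p)
      {E. \<exists>S\<subseteq>{1..n}. card S = k + 2 \<and> E \<inter> vertex_pairs S \<in> bounded_forests \<Delta> S}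
    \<le> forest_seq (2 * (alpha_crit \<Delta>)\<^sup>2 / (p / (1 - p))) (k + 2)"
proof -
  let ?K = "k + 2" and ?w = "p / (1 - p)"
  have p1: "p < 1" using p h by (metis diff_gt_0_iff_gt zero_less_power)
  have "4 * (?K choose 2) = (2 * k + 2) * ?K" by (simp add: four_choose_two)
  then have edges: "(1 - p) ^ (?K choose 2) = (h ^ (2 * k + 2)) ^ ?K"
    unfolding p(1) power_mult[symmetric] by simp
  have le1: "a_crit \<Delta> * ?w * real n * h ^ (2 * k + 2) \<le> 1"
  proof -
    have "(a_crit \<Delta> * real n * p * h ^ (2 * k)) * h ^ 2 \<le> h ^ 2 * h ^ 2"
      using thr h by (intro mult_right_mono) auto
    then have "a_crit \<Delta> * real n * p * h ^ (2 * k + 2) \<le> h ^ 4"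
      by (simp add: power_add mult_ac numeral_eq_Suc)
    then show ?thesis using h unfolding p(1) by (simp add: field_simps)
  qed
  have e: "0 \<le> forest_seq (2 * (alpha_crit \<Delta>)\<^sup>2 / ?w) ?K"
    using p p1 by (intro forest_seq_nonneg) simp
  have "(a_crit \<Delta> * ?w * real n) ^ ?K * (1 - p) ^ (?K choose 2) = (a_crit \<Delta> * ?w * real n * h ^ (2 * k + 2)) ^ ?K"
    unfolding edges power_mult_distrib ..
  also have "\<dots> \<le> 1"
    using le1 h p p1 a_crit_gt_1[OF \<Delta>] by (intro power_le_one) auto
  finally have "(a_crit \<Delta> * ?w * real n) ^ ?K * (1 - p) ^ (?K choose 2) * forest_seq (2 * (alpha_crit \<Delta>)\<^sup>2 / ?w) ?K
      \<le> forest_seq (2 * (alpha_crit \<Delta>)\<^sup>2 / ?w) ?K"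
    using mult_right_mono[OF _ e] by fastforce
  with prob_induced_forest_le[OF p(2) p1 \<Delta>, of n ?K] show ?thesis by linarith
qed

theorem theorem1:
  fixes p q :: real and \<Delta> :: nat
  assumes "0 < p" and "p < 1"
    and "q = 1 / (1 - p)"
    and "\<Delta> \<ge> 3"
  shows "(\<lambda>n. measure_pmf.prob (gnp n p)
      {E. (int (max_induced_tree \<Delta> {1..n} E) = \<lceil>2 * log q (a_crit \<Delta> * real n * p) + 1\<rceil> \<or>
           int (max_induced_tree \<Delta> {1..n} E) = \<lceil>2 * log q (a_crit \<Delta> * real n * p) + 2\<rceil>) \<and>
          (int (max_induced_forest \<Delta> {1..n} E) = \<lceil>2 * log q (a_crit \<Delta> * real n * p) + 1\<rceil> \<or>
           int (max_induced_forest \<Delta> {1..n} E) = \<lceil>2 * log q (a_crit \<Delta> * real n * p) + 2\<rceil>)})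
    \<longlonglongrightarrow> 1"
proof -
  note \<Delta> = assms(4)
  \<comment> \<open>The fourth root turns (1 - p)^(k/2) and (1 - p)^(k/4) into the natural powers
    h^(2k) and h^k.\<close>
  define h where "h = sqrt (sqrt (1 - p))"
  have "h ^ 4 = (h\<^sup>2)\<^sup>2" by (simp flip: power_mult)
  then have p: "1 - p = h ^ 4" using assms by (simp add: h_def)
  have h: "0 < h" "h < 1" using assms by (simp_all add: h_def)
  have q: "q = 1 / h ^ 4" "1 < q" using assms unfolding p[symmetric] by simp_all
  define a where "a = a_crit \<Delta>"
  have a: "0 < a" using a_crit_gt_1[OF \<Delta>] by (simp add: a_def)
  define w where "w = p / (1 - p)"
  have w: "0 < w" using assms by (simp add: w_def)
  define B where "B = Max {1, w, 1 / w}"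
  have B: "1 \<le> B" "w \<le> B" "1 / w \<le> B" by (auto simp: B_def)
  define c where "c = a * p"
  have c: "0 < c" using a assms by (simp add: c_def)
  define e where "e = forest_seq (2 * (alpha_crit \<Delta>)\<^sup>2 / w)"
  define f\<^sub>1 where "f\<^sub>1 k = c / h ^ 4 * B ^ \<Delta> * real k ^ 3 * h ^ k" for k
  define f\<^sub>2 where "f\<^sub>2 k = 1 / c * real k * (real k ^ 2 + 1) ^ \<Delta> * B ^ \<Delta> * h ^ k" for k
  \<comment> \<open>\<open>f\<^sub>1\<close> and \<open>f\<^sub>2\<close> bound the two geometric
    ratios after the threshold has eliminated n, so the total error depends on k alone and can be
    composed with \<open>K\<close>.\<close>
  define err where "err k = e (k + 2) + 2 * f\<^sub>1 k + 4 * w * h ^ k" for k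
  define L where "L n = 2 * log q (a_crit \<Delta> * real n * p)" for n :: nat
  define K where "K n = nat \<lceil>L n + 1\<rceil>" for n
  have f1: "f\<^sub>1 \<longlonglongrightarrow> 0" and f2: "f\<^sub>2 \<longlonglongrightarrow> 0" unfolding f\<^sub>1_def f\<^sub>2_def using h by real_asymp+
  have "0 < 2 * (alpha_crit \<Delta>)\<^sup>2 / w" using alpha_crit(1)[OF \<Delta>] w by simp
  then have "(\<lambda>k. e (k + 2)) \<longlonglongrightarrow> 0"
    unfolding e_def by (intro LIMSEQ_ignore_initial_segment forest_seq_tendsto_0)
  moreover have "(\<lambda>k. h ^ k) \<longlonglongrightarrow> 0" using h by real_asymp
  ultimately have "err \<longlonglongrightarrow> 0 + 2 * 0 + 4 * w * 0"
    unfolding err_def using f1 h by (intro tendsto_intros) auto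
  then have err: "err \<longlonglongrightarrow> 0" by simp
  have L: "filterlim L at_top sequentially"
    unfolding L_def mult.commute[of _ p] mult.assoc[symmetric] c_def[symmetric]
    using q(2) c by (simp add: a_def[symmetric] mult.commute[of p a] c_def[symmetric]) real_asymp
  have K: "filterlim K at_top sequentially"
    unfolding filterlim_at_top
  proof
    fix Z :: nat
    have "eventually (\<lambda>n. real Z \<le> L n) sequentially" using L by (simp add: filterlim_at_top)
    then show "eventually (\<lambda>n. Z \<le> K n) sequentially"
      by eventually_elim (simp add: K_def, linarith)
  qed
  have "eventually (\<lambda>k. f\<^sub>1 k \<le> 1 / 2 \<and> f\<^sub>2 k \<le> 1 / 2 \<and> 2 * (real k)\<^sup>2 * c * h ^ (2 * k) \<le> h ^ 4 \<and>
      fact k * a_crit \<Delta> ^ k \<le> (1 / h) ^ k * tree_count \<Delta> k \<and> 1 \<le> k) sequentially" (is "eventually ?good _")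
  proof (intro eventually_conj)
    show "eventually (\<lambda>k. f\<^sub>1 k \<le> 1 / 2) sequentially"
      by (rule eventually_mono[OF order_tendstoD(2)[OF f1, of "1 / 2"]]) auto
    show "eventually (\<lambda>k. f\<^sub>2 k \<le> 1 / 2) sequentially"
      by (rule eventually_mono[OF order_tendstoD(2)[OF f2, of "1 / 2"]]) auto
    \<comment> \<open>Together with the lower threshold inequality, this condition on k alone will
      yield 2 k^2 < n.\<close>
    have "(\<lambda>k. 2 * (real k)\<^sup>2 * c * h ^ (2 * k)) \<longlonglongrightarrow> 0" using h by real_asymp
    then have "eventually (\<lambda>k. 2 * (real k)\<^sup>2 * c * h ^ (2 * k) < h ^ 4) sequentially"
      by (rule order_tendstoD(2)) (use h in simp)
    then show "eventually (\<lambda>k. 2 * (real k)\<^sup>2 * c * h ^ (2 * k) \<le> h ^ 4) sequentially"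
      by (rule eventually_mono) simp
    show "eventually (\<lambda>k. fact k * a_crit \<Delta> ^ k \<le> (1 / h) ^ k * tree_count \<Delta> k) sequentially"
      using h by (intro tree_count_lower \<Delta>) simp
  qed (rule eventually_ge_at_top)
  then have good: "eventually (\<lambda>n. ?good (K n)) sequentially"
    using K by (rule eventually_compose_filterlim)
  \<comment> \<open>This keeps \<open>nat\<close> in \<open>K\<close> from cutting off the
    ceiling.\<close>
  have "eventually (\<lambda>n. 0 \<le> L n) sequentially" using L by (simp add: filterlim_at_top)
  moreover have "eventually (\<lambda>n. 1 \<le> n) sequentially" by (rule eventually_ge_at_top)
  ultimately have lower: "eventually (\<lambda>n. 1 - err (K n) \<le> measure_pmf.prob (gnp n p)
      {E. (int (max_induced_tree \<Delta> {1..n} E) = \<lceil>L n + 1\<rceil> \<or> int (max_induced_tree \<Delta> {1..n} E) = \<lceil>L n + 2\<rceil>) \<and>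
          (int (max_induced_forest \<Delta> {1..n} E) = \<lceil>L n + 1\<rceil> \<or> int (max_induced_forest \<Delta> {1..n} E) = \<lceil>L n + 2\<rceil>)})
      sequentially" using good
  proof eventually_elim
    case (elim n)
    let ?Ev = "{E. (int (max_induced_tree \<Delta> {1..n} E) = \<lceil>L n + 1\<rceil> \<or> int (max_induced_tree \<Delta> {1..n} E) = \<lceil>L n + 2\<rceil>) \<and>
          (int (max_induced_forest \<Delta> {1..n} E) = \<lceil>L n + 1\<rceil> \<or> int (max_induced_forest \<Delta> {1..n} E) = \<lceil>L n + 2\<rceil>)}"
    define k where "k = K n"
    have n: "0 < real n" using elim by simp
    have k_eq: "int k = \<lceil>L n + 1\<rceil>" "\<lceil>L n + 2\<rceil> = int k + 1"
      using elim by (simp_all add: k_def K_def)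
    have k: "f\<^sub>1 k \<le> 1 / 2" "f\<^sub>2 k \<le> 1 / 2" "2 * (real k)\<^sup>2 * c * h ^ (2 * k) \<le> h ^ 4"
      "fact k * a_crit \<Delta> ^ k \<le> (1 / h) ^ k * tree_count \<Delta> k" "1 \<le> k"
      using elim by (simp_all add: k_def)
    have cn: "a_crit \<Delta> * real n * p = c * real n" by (simp add: c_def a_def)
    have thr: "h ^ 4 < c * real n * h ^ (2 * k)" "c * real n * h ^ (2 * k) \<le> h ^ 2"
      using threshold_bounds[OF h q(1) _ k_eq(1)[unfolded L_def]] c n unfolding cn by simp_all
    have many: "2 * k\<^sup>2 \<le> n"
    proof -
      have "(2 * (real k)\<^sup>2) * (c * h ^ (2 * k)) < real n * (c * h ^ (2 * k))"
        using k(3) thr(1) by (simp only: mult_ac)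
      then have "2 * (real k)\<^sup>2 < real n" using c h by (simp only: mult_less_cancel_right_pos mult_pos_pos zero_less_power)
      then have "real (2 * k\<^sup>2) < real n" by simp
      then show ?thesis by linarith
    qed
    have kn: "k \<le> n" using many by (metis le_add1 le_square le_trans mult_2 power2_eq_square)
    define M where "M = real (n choose k) * tree_count \<Delta> k * (w ^ (k - 1) * (1 - p) ^ (k choose 2))"
    have M: "(1 / h) ^ k / (2 * w) \<le> M"
      unfolding M_def w_def using thr(1) a
      by (intro expected_trees_lower h p assms k many) (simp_all add: a_def[symmetric] c_def mult_ac)
    have pos: "0 < (1 / h) ^ k / (2 * w)" using h w by simp
    then have M0: "0 < M" using M by linarith
    have "2 / M \<le> 2 / ((1 / h) ^ k / (2 * w))" by (intro frac_le pos M) simp_all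
    also have "\<dots> = 4 * w * h ^ k" by (simp add: power_one_over)
    finally have M2: "2 / M \<le> 4 * w * h ^ k" .
    have h2: "h ^ (2 * k) = h ^ k * h ^ k" by (simp add: mult_2 power_add)
    have \<theta>1: "real k ^ 3 * B ^ \<Delta> / (real n * h ^ k) \<le> f\<^sub>1 k"
    proof -
      \<comment> \<open>The lower threshold makes n at least of order h^(-2k), so 1 / (n h^k) is at
        most of order h^k.\<close>
      have "h ^ 4 \<le> c * h ^ k * (real n * h ^ k)" using thr(1) unfolding h2 by (simp add: mult_ac)
      then have "1 \<le> c / h ^ 4 * h ^ k * (real n * h ^ k)" using h by (simp add: field_simps)
      then have "real k ^ 3 * B ^ \<Delta> * 1 \<le> real k ^ 3 * B ^ \<Delta> * (c / h ^ 4 * h ^ k * (real n * h ^ k))"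
        using B by (intro mult_left_mono) auto
      then show ?thesis using n h by (simp add: f\<^sub>1_def divide_le_eq mult_ac)
    qed
    have \<theta>2: "real k * real n * (real k ^ 2 + 1) ^ \<Delta> * B ^ \<Delta> * h ^ (3 * k - 1) \<le> f\<^sub>2 k"
    proof -
      \<comment> \<open>The upper threshold bounds n h^(2k) by h^2 / c, and the remaining h^(k - 1)
        supplies the decay.\<close>
      have "h ^ (3 * k - 1) = h ^ (2 * k) * h ^ (k - 1)" using k(5) by (simp flip: power_add)
      then have "c * real n * h ^ (3 * k - 1) \<le> h ^ 2 * h ^ (k - 1)"
        using mult_right_mono[OF thr(2), of "h ^ (k - 1)"] h by (simp add: mult_ac)
      also have "\<dots> \<le> h ^ k"
        unfolding power_add[symmetric] using h by (intro power_decreasing) auto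
      finally have "real n * h ^ (3 * k - 1) \<le> 1 / c * h ^ k" using c by (simp add: field_simps)
      then have "(real k * (real k ^ 2 + 1) ^ \<Delta> * B ^ \<Delta>) * (real n * h ^ (3 * k - 1)) \<le>
          (real k * (real k ^ 2 + 1) ^ \<Delta> * B ^ \<Delta>) * (1 / c * h ^ k)"
        using B by (intro mult_left_mono) auto
      then show ?thesis by (simp only: f\<^sub>2_def mult_ac)
    qed
    define Bad\<^sub>1 where "Bad\<^sub>1 = {E. \<exists>S\<subseteq>{1..n}. card S = k + 2 \<and> E \<inter> vertex_pairs S \<in> bounded_forests \<Delta> S}"
    define Bad\<^sub>2 where "Bad\<^sub>2 = {E. \<forall>S\<subseteq>{1..n}. card S = k \<longrightarrow> E \<inter> vertex_pairs S \<notin> bounded_trees \<Delta> S}"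
    have bad1: "measure_pmf.prob (gnp n p) Bad\<^sub>1 \<le> e (k + 2)"
      unfolding Bad\<^sub>1_def e_def w_def
      by (rule prob_forest_at_threshold[OF h p assms(1) \<Delta>]) (simp only: cn thr(2))
    have "measure_pmf.prob (gnp n p) Bad\<^sub>2 \<le> 2 * (real k ^ 3 * B ^ \<Delta> / (real n * h ^ k)) + 2 / M"
      unfolding Bad\<^sub>2_def M_def w_def
      by (rule prob_no_induced_tree_le[OF h p k(5) kn B[unfolded w_def] M0[unfolded M_def w_def]
          order_trans[OF \<theta>1 k(1)] order_trans[OF \<theta>2 k(2)]])
    then have bad2: "measure_pmf.prob (gnp n p) Bad\<^sub>2 \<le> 2 * f\<^sub>1 k + 4 * w * h ^ k"
      using \<theta>1 M2 by linarith
    \<comment> \<open>Intersecting with the support provides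
      \<open>E \<subseteq> vertex_pairs {1..n}\<close>, under which the two maxima are expressed
      through \<open>bounded_trees\<close> and \<open>bounded_forests\<close>.\<close>
    have "- ?Ev \<inter> set_pmf (gnp n p) \<subseteq> Bad\<^sub>1 \<union> Bad\<^sub>2"
    proof
      fix E assume E: "E \<in> - ?Ev \<inter> set_pmf (gnp n p)"
      show "E \<in> Bad\<^sub>1 \<union> Bad\<^sub>2"
      proof (rule ccontr)
        assume nb: "E \<notin> Bad\<^sub>1 \<union> Bad\<^sub>2"
        then obtain S where S: "S \<subseteq> {1..n}" "card S = k" "E \<inter> vertex_pairs S \<in> bounded_trees \<Delta> S"
          unfolding Bad\<^sub>2_def by blast
        have no: "E \<inter> vertex_pairs S' \<notin> bounded_forests \<Delta> S'" if "S' \<subseteq> {1..n}" "card S' = k + 2" for S'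
          using nb that unfolding Bad\<^sub>1_def by blast
        have sub: "E \<subseteq> vertex_pairs {1..n}" using E set_gnp by blast
        have "k \<le> max_induced_tree \<Delta> {1..n} E" "max_induced_tree \<Delta> {1..n} E \<le> max_induced_forest \<Delta> {1..n} E"
          "max_induced_forest \<Delta> {1..n} E < k + 2"
          by (rule max_induced_between[OF _ sub S no]; simp)+
        then have "E \<in> ?Ev" unfolding k_eq(2) k_eq(1)[symmetric] mem_Collect_eq by linarith
        then show False using E by blast
      qed
    qed
    then have "measure_pmf.prob (gnp n p) (- ?Ev \<inter> set_pmf (gnp n p)) \<le> measure_pmf.prob (gnp n p) (Bad\<^sub>1 \<union> Bad\<^sub>2)"
      by (intro measure_pmf.finite_measure_mono) auto
    also have "\<dots> \<le> measure_pmf.prob (gnp n p) Bad\<^sub>1 + measure_pmf.prob (gnp n p) Bad\<^sub>2"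
      by (intro measure_Un_le) auto
    also have "\<dots> \<le> err k" using bad1 bad2 by (simp add: err_def)
    finally have "measure_pmf.prob (gnp n p) (- ?Ev) \<le> err k" by (simp only: measure_Int_set_pmf)
    then show ?case
      using measure_pmf.prob_compl[of ?Ev "gnp n p"] by (simp add: Compl_eq_Diff_UNIV k_def)
  qed
  have "(\<lambda>n. 1 - err (K n)) \<longlonglongrightarrow> 1 - 0"
    by (intro tendsto_intros filterlim_compose[OF err K])
  then have "(\<lambda>n. 1 - err (K n)) \<longlonglongrightarrow> 1" by simp
  then show ?thesis
    unfolding L_def[symmetric]
    by (rule tendsto_sandwich[OF lower _ _ tendsto_const, rotated]) auto
qed

end
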